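(* Let $\xi\in E_2$, i.e. let $\xi\in\{0,1\}^\omega$ be such that the Schreier graph $\Gamma_\xi$ of the Basilica group has two ends. Then $\Gamma_\xi$ is isomorphic (as an unrooted graph) to the graph $\Gamma(\xi)$ described in the context.
   Context: The Basilica group $B=\langle a,b\rangle$ acts on finite and infinite binary words by $a(0w)=0\,b(w)$, $a(1w)=1w$, $b(0w)=1\,a(w)$, $b(1w)=0w$. For $n\ge1$, $\Gamma_n$ is the undirected multigraph with vertex set $\{0,1\}^n$ and, for every vertex $x$ and $s\in\{a,b\}$, one edge joining $x$ and $s(x)$ (a loop if $s(x)=x$; parallel edges allowed; a loop contributes 2 to the degree). For $\xi\in\{0,1\}^\omega$, $\Gamma_\xi$ is defined in the same way on the vertex set $B\cdot\xi$. Labels are forgotten. Explicitly, $E_2$ is the set of $\xi=\alpha_1\beta_1\alpha_2\beta_2\ldots$ ($\alpha_i,\beta_i\in\{0,1\}$) such that at least one of the sequences $\{\alpha_i\},\{\beta_i\}$ contains only finitely many $1$'s and $\xi$ is not of the form $w0^\omega$ or $w(01)^\omega$ with $w$ a finite word. Exactly one of $\{\alpha_i\},\{\beta_i\}$ then has finitely many $1$'s; $E_{2,even}$ (resp. $E_{2,odd}$) is the set of $\xi\in E_2$ for which it is $\{\alpha_i\}$ (resp. $\{\beta_i\}$). The $k$-decoration ($k\ge1$) is the following graph $\mathcal D(0^k)$. For $k=1$ it is a single vertex with a loop. For $k\ge2$, removing the vertex $0^k$ from $\Gamma_k$ leaves exactly two connected components; let $U$ be the one not containing $0^{k-1}1$;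 then $\mathcal D(0^k)$ is the subgraph of $\Gamma_k$ induced by $V(U)\cup\{0^k\}$. In each $k$-decoration the vertex $0^k$ is the unique vertex of degree 2. The graph $\Gamma(\xi)$: if $\xi\in E_{2,even}$, set $A'_0=2\mathbb Z$ and $A'_k=\{n\in\mathbb Z : n\equiv 2^k-1-\sum_{i=1}^k2^i\beta_{i+1}\bmod 2^{k+1}\}$ for $k\ge1$ (these sets partition $\mathbb Z$). Take the bi-infinite path with vertex set $\mathbb Z$ (consecutive integers joined by one edge) and, for every $k\ge0$, attach to each vertex in $A'_k$ a $(2k+2)$-decoration, identifying that vertex with the unique vertex of degree 2 of the decoration. If $\xi\in E_{2,odd}$, $\Gamma(\xi)$ is defined in the same way with $\alpha_{i+1}$ in place of $\beta_{i+1}$ in the definition of $A'_k$, and with $(2k+1)$-decorations instead of $(2k+2)$-decorations. *)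

theory Defs
  imports
    "HOL-Library.Stream"
    "HOL-Library.Uprod"
    "HOL-Number_Theory.Cong"
    "HOL-Algebra.Bij"
    "HOL-Algebra.Generated_Groups"
begin

section \<open>Undirected multigraphs\<close>

text \<open>Edges have an identity of their own and an unordered pair of endpoints, so parallel edges
  and loops (edges with endpoints \<^term>\<open>Upair x x\<close>) are allowed.\<close>

record ('v, 'e) mgraph =
  verts :: "'v set"
  edges :: "'e set"
  ends :: "'e \<Rightarrow> 'v uprod"

definition mgraph_iso :: "('v, 'e) mgraph \<Rightarrow> ('w, 'f) mgraph \<Rightarrow> bool" where
  "mgraph_iso G H \<longleftrightarrow>
    (\<exists>f \<phi>. bij_betw f (verts G) (verts H) \<and> bij_betw \<phi> (edges G) (edges H) \<and>
      (\<forall>e\<in>edges G. ends H (\<phi> e) = map_uprod f (ends G e)))"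

definition induced :: "('v, 'e) mgraph \<Rightarrow> 'v set \<Rightarrow> ('v, 'e) mgraph" where
  "induced G W =
    \<lparr>verts = verts G \<inter> W, edges = {e \<in> edges G. set_uprod (ends G e) \<subseteq> W}, ends = ends G\<rparr>"

definition adj :: "('v, 'e) mgraph \<Rightarrow> ('v \<times> 'v) set" where
  "adj G = {(x, y). \<exists>e\<in>edges G. ends G e = Upair x y}"

text \<open>A connected component is represented by its vertex set.\<close>

definition components :: "('v, 'e) mgraph \<Rightarrow> 'v set set" where
  "components G = {{y. (x, y) \<in> (adj G)\<^sup>*} | x. x \<in> verts G}"


section \<open>The Basilica group and its Schreier graphs\<close>

text \<open>The letters 0 and 1 are \<^term>\<open>False\<close> and \<^term>\<open>True\<close>.\<close>

datatype gen = Gen_a | Gen_b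

fun fin_a :: "bool list \<Rightarrow> bool list" and fin_b :: "bool list \<Rightarrow> bool list" where
  "fin_a [] = []"
| "fin_a (False # w) = False # fin_b w"
| "fin_a (True # w) = True # w"
| "fin_b [] = []"
| "fin_b (False # w) = True # fin_a w"
| "fin_b (True # w) = False # w"

fun other :: "gen \<Rightarrow> gen" where
  "other Gen_a = Gen_b"
| "other Gen_b = Gen_a"

primcorec inf_act :: "gen \<Rightarrow> bool stream \<Rightarrow> bool stream" where
  "shd (inf_act s w) = (case s of Gen_a \<Rightarrow> shd w | Gen_b \<Rightarrow> \<not> shd w)"
| "stl (inf_act s w) = (if shd w then stl w else inf_act (other s) (stl w))"

abbreviation inf_a :: "bool stream \<Rightarrow> bool stream" where "inf_a \<equiv> inf_act Gen_a"
abbreviation inf_b :: "bool stream \<Rightarrow> bool stream" where "inf_b \<equiv> inf_act Gen_b"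

text \<open>The recursion of the generators, in the form that defines the group.\<close>

lemma inf_a_SCons:
  "inf_a (False ## w) = False ## inf_b w"
  "inf_a (True ## w) = True ## w"
  by (simp_all add: stream.expand)

lemma inf_b_SCons:
  "inf_b (False ## w) = True ## inf_a w"
  "inf_b (True ## w) = False ## w"
  by (simp_all add: stream.expand)

fun fin_act :: "gen \<Rightarrow> bool list \<Rightarrow> bool list" where
  "fin_act Gen_a = fin_a"
| "fin_act Gen_b = fin_b"

text \<open>The Basilica group acts faithfully on infinite words, so it is the subgroup generated by
  \<^term>\<open>inf_a\<close> and \<^term>\<open>inf_b\<close> in the group of all permutations of the infinite words.\<close>

definition basilica :: "(bool stream \<Rightarrow> bool stream) set" where
  "basilica = generate (BijGroup UNIV) {inf_a, inf_b}"

definition basilica_orbit :: "bool stream \<Rightarrow> bool stream set" where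
  "basilica_orbit \<xi> = {g \<xi> | g. g \<in> basilica}"

text \<open>The generators are indeed permutations; this is needed for inverses in
  \<^term>\<open>BijGroup UNIV\<close> to be the inverse functions.\<close>

primcorec inv_act :: "gen \<Rightarrow> bool stream \<Rightarrow> bool stream" where
  "shd (inv_act s w) = (case s of Gen_a \<Rightarrow> shd w | Gen_b \<Rightarrow> \<not> shd w)"
| "stl (inv_act s w) =
    (if shd w = (s = Gen_a) then stl w else inv_act (other s) (stl w))"

lemma inv_inf_act: "inv_act s (inf_act s w) = w"
proof -
  have "v = w" if "v = w \<or> (\<exists>s. v = inv_act s (inf_act s w))" for v
    using that
  proof (coinduction arbitrary: v w)
    case Eq_stream
    then show ?case by (auto split: gen.splits) blast+
  qed
  then show ?thesis by blast
qed

lemma inf_inv_act: "inf_act s (inv_act s w) = w"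
proof -
  have "v = w" if "v = w \<or> (\<exists>s. v = inf_act s (inv_act s w))" for v
    using that
  proof (coinduction arbitrary: v w)
    case Eq_stream
    then show ?case by (auto split: gen.splits) blast+
  qed
  then show ?thesis by blast
qed

lemma generators_in_BijGroup: "{inf_a, inf_b} \<subseteq> carrier (BijGroup UNIV)"
proof -
  have "bij (inf_act s)" for s
    by (rule o_bij[of "inv_act s"]) (auto simp: fun_eq_iff inv_inf_act inf_inv_act)
  then show ?thesis by (simp add: BijGroup_def Bij_def)
qed

definition schreier :: "'v set \<Rightarrow> (gen \<Rightarrow> 'v \<Rightarrow> 'v) \<Rightarrow> ('v, 'v \<times> gen) mgraph" where
  "schreier V act = \<lparr>verts = V, edges = V \<times> UNIV, ends = (\<lambda>(x, s). Upair x (act s x))\<rparr>"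

definition Gamma_fin :: "nat \<Rightarrow> (bool list, bool list \<times> gen) mgraph" where
  "Gamma_fin n = schreier {w. length w = n} fin_act"

definition Gamma_inf :: "bool stream \<Rightarrow> (bool stream, bool stream \<times> gen) mgraph" where
  "Gamma_inf \<xi> = schreier (basilica_orbit \<xi>) inf_act"


section \<open>The set $E_2$\<close>

text \<open>In $\xi = \alpha_1\beta_1\alpha_2\beta_2\ldots$ the indices start at 1, whereas \<^term>\<open>(!!)\<close>
  counts from 0. Only the values at indices \<^term>\<open>i \<ge> 1\<close> are meaningful.\<close>

definition alpha :: "bool stream \<Rightarrow> nat \<Rightarrow> bool" where
  "alpha \<xi> i = \<xi> !! (2 * i - 2)"

definition beta :: "bool stream \<Rightarrow> nat \<Rightarrow> bool" where
  "beta \<xi> i = \<xi> !! (2 * i - 1)"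

definition finitely_many_ones :: "(nat \<Rightarrow> bool) \<Rightarrow> bool" where
  "finitely_many_ones \<gamma> \<longleftrightarrow> finite {i. i \<ge> 1 \<and> \<gamma> i}"

text \<open>These are the infinite words whose Schreier graph has two ends.\<close>

definition E2 :: "bool stream set" where
  "E2 = {\<xi>. (finitely_many_ones (alpha \<xi>) \<or> finitely_many_ones (beta \<xi>)) \<and>
    \<not> (\<exists>w. \<xi> = w @- sconst False) \<and> \<not> (\<exists>w. \<xi> = w @- cycle [False, True])}"

definition E2_even :: "bool stream set" where
  "E2_even = {\<xi> \<in> E2. finitely_many_ones (alpha \<xi>)}"

definition E2_odd :: "bool stream set" where
  "E2_odd = {\<xi> \<in> E2. finitely_many_ones (beta \<xi>)}"


section \<open>Decorations and the graph $\Gamma(\xi)$\<close>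

definition zeros :: "nat \<Rightarrow> bool list" where
  "zeros k = replicate k False"

definition decoration :: "nat \<Rightarrow> (bool list, bool list \<times> gen) mgraph" where
  "decoration k =
    (if k = 1
     then \<lparr>verts = {zeros 1}, edges = {(zeros 1, Gen_a)}, ends = (\<lambda>_. Upair (zeros 1) (zeros 1))\<rparr>
     else induced (Gamma_fin k)
       (insert (zeros k)
         (THE U. U \<in> components (induced (Gamma_fin k) (verts (Gamma_fin k) - {zeros k})) \<and>
           zeros (k - 1) @ [True] \<notin> U)))"

text \<open>The bi-infinite path on the integers with a copy of \<^term>\<open>decoration (d k)\<close> attached at each
  \<^term>\<open>n \<in> A k\<close>. The vertex \<^term>\<open>Inl n\<close> is the integer \<^term>\<open>n\<close>; the root \<^term>\<open>zeros (d k)\<close> of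
  the copy at \<^term>\<open>n\<close>, its unique vertex of degree 2, is identified with \<^term>\<open>Inl n\<close>, and any
  other vertex \<^term>\<open>w\<close> of that copy is \<^term>\<open>Inr (n, k, w)\<close>. The edge \<^term>\<open>Inl n\<close> joins
  \<^term>\<open>n\<close> and \<^term>\<open>n + 1\<close>.\<close>

definition glue :: "(nat \<Rightarrow> nat) \<Rightarrow> int \<Rightarrow> nat \<Rightarrow> bool list \<Rightarrow> int + int \<times> nat \<times> bool list" where
  "glue d n k w = (if w = zeros (d k) then Inl n else Inr (n, k, w))"

definition decorated_path ::
  "(nat \<Rightarrow> int set) \<Rightarrow> (nat \<Rightarrow> nat) \<Rightarrow>
    (int + int \<times> nat \<times> bool list, int + int \<times> nat \<times> (bool list \<times> gen)) mgraph" where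
  "decorated_path A d =
    \<lparr>verts = range Inl \<union> {glue d n k w | n k w. n \<in> A k \<and> w \<in> verts (decoration (d k))},
     edges = range Inl \<union> {Inr (n, k, e) | n k e. n \<in> A k \<and> e \<in> edges (decoration (d k))},
     ends = (\<lambda>e. case e of
        Inl n \<Rightarrow> Upair (Inl n) (Inl (n + 1))
      | Inr (n, k, e) \<Rightarrow> map_uprod (glue d n k) (ends (decoration (d k)) e))\<rparr>"

definition A' :: "(nat \<Rightarrow> bool) \<Rightarrow> nat \<Rightarrow> int set" where
  "A' \<gamma> k =
    (if k = 0 then {n. even n}
     else {n. [n = 2 ^ k - 1 - (\<Sum>i=1..k. 2 ^ i * of_bool (\<gamma> (i + 1)))] (mod 2 ^ (k + 1))})"

text \<open>Only meaningful for \<^term>\<open>\<xi> \<in> E2\<close>, which is the disjoint union of \<^term>\<open>E2_even\<close> and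
  \<^term>\<open>E2_odd\<close>.\<close>

definition model_graph ::
  "bool stream \<Rightarrow>
    (int + int \<times> nat \<times> bool list, int + int \<times> nat \<times> (bool list \<times> gen)) mgraph" where
  "model_graph \<xi> =
    (if \<xi> \<in> E2_even then decorated_path (A' (beta \<xi>)) (\<lambda>k. 2 * k + 2)
     else decorated_path (A' (alpha \<xi>)) (\<lambda>k. 2 * k + 1))"

end

theory Submission
  imports Defs
begin

text \<open>
  A generator reads a word from the left. It acts alternately as \<^term>\<open>Gen_a\<close> and as
  \<^term>\<open>Gen_b\<close>, and the first letter 1 stops it; in its \<^term>\<open>Gen_b\<close> steps it
  turns 0 into 1 and goes on, or turns 1 into 0 and stops. So, on the letters where it acts as
  \<^term>\<open>Gen_b\<close>, it is the binary odometer running backwards (subtraction of 1 with borrow), as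
  long as all other letters are 0.

  The action is self-replicating (\<open>gen_path_SCons\<close>), so the orbit of \<^term>\<open>\<xi>\<close>
  consists of the words that agree with \<^term>\<open>\<xi>\<close> from some point on; the words that a
  generator or its inverse changes at infinitely many places are excluded from \<^term>\<open>E2\<close>. Let
  the frozen letters be the \<open>\<alpha>\<^sub>i\<close> in the even case and the
  \<open>\<beta>\<^sub>i\<close> in the odd case, and call the other letters digits. On the words of the orbit
  in which all frozen letters are 0, one generator \<^term>\<open>c\<close> subtracts 1 from the 2-adic integer
  given by the digits. The digits are not eventually constant, so these words form one bi-infinite
  \<^term>\<open>c\<close>-path, the main line. The difference to the digits of \<^term>\<open>\<xi>\<close>
  gives integer coordinates on it (\<open>pos_bij\<close>), and fixing the place of the first digit 1 fixes a
  residue class of the coordinate, which is \<^term>\<open>A' \<gamma> k\<close> (\<open>pos_in_A'_iff\<close>).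

  The decorations come from the finite graphs. A step between nonzero finite words preserves the parity of the
  number of trailing zeros (\<open>fin_act_trailing_zeros\<close>), and each parity class is connected
  (\<open>same_side_connected\<close>). So the set \<^term>\<open>U\<close> in the definition of a decoration
  consists of the words of length \<^term>\<open>k\<close> with an odd number of trailing zeros, apart from
  \<^term>\<open>zeros k\<close> itself.

  To put these together, take a word of the orbit and the first digit 1 that comes after all its frozen letters
  1. Replacing all letters before that digit by 0 gives a word on the main line; the letters that were replaced,
  followed by a 0, form a word in a decoration, since their last 1, if there is one, is a frozen letter. This is
  a bijection (\<open>hang_bij\<close>). It commutes with the generators except along the
  \<^term>\<open>c\<close>-edges of the main line (\<open>hang_act\<close>), because any other carry that passes
  over all replaced letters arrives as \<^term>\<open>Gen_a\<close> at the digit 1, and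
  \<^term>\<open>Gen_a\<close> changes neither a final 1 nor a final 0.
\<close>

section \<open>The action on words, with the carry made explicit\<close>

text \<open>A generator reads a word from left to right and alternates between acting as
  \<^term>\<open>Gen_a\<close> and as \<^term>\<open>Gen_b\<close>, until the first letter 1 stops it.
  This is the generator that acts at the letter with index \<^term>\<open>j\<close>, if all earlier letters
  are 0.\<close>

definition gen_at :: "gen \<Rightarrow> nat \<Rightarrow> gen" where
  "gen_at s j = (if even j then s else other s)"

lemma other_other [simp]: "other (other s) = s"
  by (cases s) auto

lemma other_eq_iff [simp]: "other s = Gen_b \<longleftrightarrow> s = Gen_a" "other s = Gen_a \<longleftrightarrow> s = Gen_b"
  by (cases s; simp)+

lemma other_neq [simp]: "s \<noteq> other s"
  by (cases s; simp)

lemma gen_not_a [simp]: "s \<noteq> Gen_a \<longleftrightarrow> s = Gen_b"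
  by (cases s) auto

lemma gen_not_b [simp]: "s \<noteq> Gen_b \<longleftrightarrow> s = Gen_a"
  by (cases s) auto

lemma gen_at_0 [simp]: "gen_at s 0 = s"
  by (simp add: gen_at_def)

lemma gen_at_Suc: "gen_at s (Suc j) = other (gen_at s j)"
  by (simp add: gen_at_def)

lemma gen_at_other: "gen_at (other s) j = other (gen_at s j)"
  by (simp add: gen_at_def)

lemma length_zeros [simp]: "length (zeros n) = n"
  by (simp add: zeros_def)

lemma zeros_0 [simp]: "zeros 0 = []"
  by (simp add: zeros_def)

lemma zeros_Suc: "zeros (Suc n) = False # zeros n"
  by (simp add: zeros_def)

lemma zeros_snoc: "zeros (Suc n) = zeros n @ [False]"
  by (simp add: zeros_def replicate_append_same)

lemma nth_zeros [simp]: "j < n \<Longrightarrow> zeros n ! j = False"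
  by (simp add: zeros_def)

lemma fin_act_Nil [simp]: "fin_act s [] = []"
  by (cases s) auto

lemma fin_act_0: "fin_act s (False # w) = (s = Gen_b) # fin_act (other s) w"
  by (cases s) auto

lemma fin_act_1: "fin_act s (True # w) = (s = Gen_a) # w"
  by (cases s) auto

lemma length_fin_act [simp]: "length (fin_act s w) = length w"
proof (induction w arbitrary: s)
  case (Cons x w)
  then show ?case by (cases x) (auto simp: fin_act_0 fin_act_1)
qed simp

lemma inf_act_0: "inf_act s (False ## w) = (s = Gen_b) ## inf_act (other s) w"
  by (cases s) (auto simp: inf_a_SCons inf_b_SCons)

lemma inf_act_1: "inf_act s (True ## w) = (s = Gen_a) ## w"
  by (cases s) (auto simp: inf_a_SCons inf_b_SCons)

lemma fin_act_append_no_carry: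
  "u \<noteq> zeros (length u) \<Longrightarrow> fin_act s (u @ w) = fin_act s u @ w"
proof (induction u arbitrary: s)
  case (Cons x u)
  then show ?case by (cases x) (auto simp: fin_act_0 fin_act_1 zeros_Suc)
qed simp

lemma inf_act_shift_no_carry:
  "u \<noteq> zeros (length u) \<Longrightarrow> inf_act s (u @- w) = fin_act s u @- w"
proof (induction u arbitrary: s)
  case (Cons x u)
  then show ?case by (cases x) (auto simp: fin_act_0 fin_act_1 inf_act_0 inf_act_1 zeros_Suc)
qed simp

lemma fin_act_append_carry:
  "fin_act s (zeros n @ w) = fin_act s (zeros n) @ fin_act (gen_at s n) w"
  by (induction n arbitrary: s)
    (auto simp: zeros_Suc fin_act_0 gen_at_Suc gen_at_other)

lemma inf_act_shift_carry:
  "inf_act s (zeros n @- w) = fin_act s (zeros n) @- inf_act (gen_at s n) w"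
  by (induction n arbitrary: s)
    (auto simp: zeros_Suc fin_act_0 inf_act_0 gen_at_Suc gen_at_other)

lemma nth_fin_act_zeros: "j < n \<Longrightarrow> fin_act s (zeros n) ! j = (gen_at s j = Gen_b)"
proof (induction n arbitrary: s j)
  case (Suc n)
  then show ?case by (cases j) (auto simp: zeros_Suc fin_act_0 gen_at_Suc gen_at_other)
qed simp

lemma fin_act_zeros_Suc:
  "fin_act s (zeros (Suc n)) = fin_act s (zeros n) @ [gen_at s n = Gen_b]"
  unfolding zeros_snoc fin_act_append_carry by (simp add: fin_act_0)


section \<open>Trailing zeros and the two sides of the zero word\<close>

definition trailing_zeros :: "bool list \<Rightarrow> nat" where
  "trailing_zeros w = length (takeWhile Not (rev w))"

lemma trailing_zeros_snoc [simp]: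
  "trailing_zeros (w @ [x]) = (if x then 0 else Suc (trailing_zeros w))"
  by (simp add: trailing_zeros_def)

lemma trailing_zeros_Nil [simp]: "trailing_zeros [] = 0"
  by (simp add: trailing_zeros_def)

lemma trailing_zeros_append_zeros [simp]: "trailing_zeros (w @ zeros t) = trailing_zeros w + t"
proof (induction t)
  case (Suc t)
  then show ?case
    using trailing_zeros_snoc[of "w @ zeros t" False] by (simp add: zeros_snoc)
qed simp

lemma trailing_zeros_last_one [simp]: "trailing_zeros (p @ True # zeros t) = t"
  using trailing_zeros_append_zeros[of "p @ [True]" t] by simp

lemma last_one_neq_zeros [simp]: "p @ True # w \<noteq> zeros n"
proof
  assume "p @ True # w = zeros n"
  then have "True \<in> set (zeros n)" by (metis in_set_conv_decomp)
  then show False by (simp add: zeros_def)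
qed

lemma snoc_eq_zeros_iff [simp]: "w @ [x] = zeros (Suc n) \<longleftrightarrow> w = zeros n \<and> \<not> x"
  by (auto simp: zeros_snoc)

lemma last_one_cases:
  assumes "w \<noteq> zeros (length w)"
  obtains p where "w = p @ True # zeros (trailing_zeros w)"
proof -
  have "\<exists>p. w = p @ True # zeros (trailing_zeros w)"
    using assms
  proof (induction w rule: rev_induct)
    case (snoc x w)
    then show ?case by (cases x) (auto simp: zeros_snoc)
  qed simp
  then show ?thesis using that by blast
qed

text \<open>The last 1 can change only if all letters before it are 0 and the generator acts there
  as \<^term>\<open>Gen_b\<close>. It is then deleted, and a 1 is written two places to its left, where the
  generator acted as \<^term>\<open>Gen_b\<close> as well; if there is no such place, the zero word results. So the
  parity of the number of trailing zeros tells the sides of the zero word in the finite Schreier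
  graph apart.\<close>

lemma fin_act_trailing_zeros:
  assumes "w \<noteq> zeros (length w)"
  shows "fin_act s w = zeros (length w) \<or>
    fin_act s w \<noteq> zeros (length w) \<and> even (trailing_zeros (fin_act s w)) = even (trailing_zeros w)"
proof -
  obtain p where w: "w = p @ True # zeros (trailing_zeros w)"
    using assms by (rule last_one_cases)
  define t where "t = trailing_zeros w"
  have w': "w = p @ True # zeros t" using w t_def by simp
  have len: "length w = Suc (length p + t)" and tz: "trailing_zeros w = t"
    unfolding w' by simp_all
  show ?thesis
  proof (cases "p = zeros (length p)")
    case False
    then have "fin_act s w = fin_act s p @ True # zeros t"
      unfolding w' by (rule fin_act_append_no_carry)
    then show ?thesis unfolding tz by simp
  next
    case True
    define n where "n = length p"
    have p: "p = zeros n" using True n_def by simp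
    have sw: "fin_act s w = fin_act s (zeros n) @ (gen_at s n = Gen_a) # zeros t"
      unfolding w' p fin_act_append_carry by (simp add: fin_act_1)
    show ?thesis
    proof (cases "gen_at s n = Gen_a")
      case True
      then show ?thesis unfolding sw tz by simp
    next
      case False
      then have b: "gen_at s n = Gen_b" by simp
      have sw': "fin_act s w = fin_act s (zeros n) @ zeros (Suc t)"
        unfolding sw using b by (simp add: zeros_Suc)
      consider "n = 0" | "n = 1" | m where "n = Suc (Suc m)"
        by (metis One_nat_def not0_implies_Suc)
      then show ?thesis
      proof cases
        case 1
        then have "fin_act s w = zeros (length w)" unfolding sw' len p by simp
        then show ?thesis by simp
      next
        case 2
        then have "s = Gen_a" using b by (cases s) (auto simp: gen_at_def)
        then have "fin_act s w = zeros (Suc (Suc t))"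
          unfolding sw' 2 by (simp add: zeros_Suc fin_act_0)
        then show ?thesis unfolding len p 2 by simp
      next
        case 3
        then have "gen_at s m = Gen_b" using b by (simp add: gen_at_Suc)
        then have "fin_act s w = fin_act s (zeros m) @ True # zeros (Suc (Suc t))"
          unfolding sw' 3 fin_act_zeros_Suc by (simp add: gen_at_Suc zeros_Suc)
        then show ?thesis unfolding tz by simp
      qed
    qed
  qed
qed

text \<open>The vertices of a decoration: the zero word and one side of it. The other side consists of
  the nonzero words with an even number of trailing zeros.\<close>

definition branch :: "nat \<Rightarrow> bool list set" where
  "branch k = {w. length w = k \<and> (w = zeros k \<or> odd (trailing_zeros w))}"

lemma zeros_in_branch [simp]: "zeros k \<in> branch k"
  by (simp add: branch_def)

lemma fin_act_branch:
  assumes "w \<in> branch k" "w \<noteq> zeros k"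
  shows "fin_act s w \<in> branch k"
  using assms fin_act_trailing_zeros[of w s] by (auto simp: branch_def)

lemma fin_act_zeros_branch:
  assumes "k \<ge> 1"
  shows "fin_act s (zeros k) \<in> branch k \<longleftrightarrow> gen_at s k = Gen_b"
proof -
  obtain n where k: "k = Suc n" using assms by (cases k) auto
  show ?thesis
  proof (cases "gen_at s n = Gen_b")
    case True
    then show ?thesis
      unfolding k fin_act_zeros_Suc by (auto simp: branch_def gen_at_Suc)
  next
    case False
    then have s: "fin_act s (zeros k) = fin_act s (zeros n) @ [False]"
      unfolding k fin_act_zeros_Suc by simp
    show ?thesis
    proof (cases n)
      case 0
      then show ?thesis using s False k by (auto simp: gen_at_Suc zeros_snoc branch_def)
    next
      case (Suc m)
      have "gen_at s m = Gen_b" using False unfolding Suc by (simp add: gen_at_Suc)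
      then have "trailing_zeros (fin_act s (zeros k)) = 1"
        unfolding s Suc fin_act_zeros_Suc using trailing_zeros_last_one[of _ 1]
        by (simp add: zeros_Suc)
      then show ?thesis using False k by (simp add: branch_def gen_at_Suc)
    qed
  qed
qed

section \<open>The decorations\<close>

text \<open>The adjacency that remains in the finite Schreier graph when the zero word is removed.\<close>

definition nonzero_step :: "nat \<Rightarrow> (bool list \<times> bool list) set" where
  "nonzero_step k = {(x, y). length x = k \<and> length y = k \<and> x \<noteq> zeros k \<and> y \<noteq> zeros k \<and>
    (\<exists>s. y = fin_act s x \<or> x = fin_act s y)}"

lemma adj_minus_zeros:
  "adj (induced (Gamma_fin k) (verts (Gamma_fin k) - {zeros k})) = nonzero_step k"
proof -
  have "(x, y) \<in> adj (induced (Gamma_fin k) (verts (Gamma_fin k) - {zeros k})) \<longleftrightarrow>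
      (\<exists>u s. length u = k \<and> {u, fin_act s u} \<subseteq> {w. length w = k} - {zeros k} \<and>
        Upair u (fin_act s u) = Upair x y)" for x y
    by (simp add: adj_def induced_def Gamma_fin_def schreier_def conj_ac)
  then show ?thesis by (auto simp: nonzero_step_def)
qed

lemma sym_nonzero_step: "sym (nonzero_step k)"
  by (auto simp: sym_def nonzero_step_def)

lemma nonzero_path_sym: "(x, y) \<in> (nonzero_step k)\<^sup>* \<Longrightarrow> (y, x) \<in> (nonzero_step k)\<^sup>*"
  using sym_rtrancl[OF sym_nonzero_step] by (rule symD)

lemma nonzero_step_fin_act:
  assumes "length x = k" "x \<noteq> zeros k" "fin_act s x \<noteq> zeros k"
  shows "(x, fin_act s x) \<in> (nonzero_step k)\<^sup>*"
  using assms by (auto simp: nonzero_step_def)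

text \<open>A generator stops inside a nonzero word, so it does not reach a letter appended at the end.\<close>

lemma nonzero_path_snoc:
  assumes "(x, y) \<in> (nonzero_step k)\<^sup>*"
  shows "(x @ [c], y @ [c]) \<in> (nonzero_step (Suc k))\<^sup>*"
  using assms
proof (induction rule: rtrancl_induct)
  case (step y z)
  have "(y @ [c], z @ [c]) \<in> nonzero_step (Suc k)"
  proof -
    obtain s where s: "length y = k" "length z = k" "y \<noteq> zeros k" "z \<noteq> zeros k"
      "z = fin_act s y \<or> y = fin_act s z"
      using step(2) by (auto simp: nonzero_step_def)
    then have "fin_act s (y @ [c]) = fin_act s y @ [c]" "fin_act s (z @ [c]) = fin_act s z @ [c]"
      by (simp_all add: fin_act_append_no_carry)
    then show ?thesis using s unfolding nonzero_step_def by clarsimp metis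
  qed
  then show ?case using step by simp
qed simp

text \<open>Each side of the zero word is connected. Appending a letter to the words of length
  \<^term>\<open>k\<close> other than \<^term>\<open>zeros k\<close> gives four connected pieces. The even side with a 0
  appended is the whole odd side for length \<^term>\<open>Suc k\<close>. The other three pieces make up the
  even side, and they hang together at the word \<^term>\<open>zeros k @ [True]\<close>: the generator that acts as
  \<^term>\<open>Gen_a\<close> on its last letter leads to the even piece, the other one leads to the odd
  side with a 0 appended and, backwards, to the odd side with a 1 appended.\<close>

lemma same_side_connected:
  assumes "length x = k" "x \<noteq> zeros k" "length y = k" "y \<noteq> zeros k"
    and "even (trailing_zeros x) = even (trailing_zeros y)"
  shows "(x, y) \<in> (nonzero_step k)\<^sup>*"
  using assms
proof (induction k arbitrary: x y)
  case (Suc k)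
  let ?R = "(nonzero_step (Suc k))\<^sup>*"
  let ?base = "zeros k @ [True]"
  have to_base: "(u @ [c], ?base) \<in> ?R"
    if len: "length u = k" and nz: "u @ [c] \<noteq> zeros (Suc k)" and ev: "even (trailing_zeros (u @ [c]))"
    for u c
  proof (cases "u = zeros k")
    case True
    then show ?thesis using nz by auto
  next
    case False
    then obtain n where k: "k = Suc n" using len by (cases k) auto
    define s where "s = gen_at Gen_a k"
    have s: "gen_at s k = Gen_a" "gen_at (other s) k = Gen_b"
      by (simp_all add: s_def gen_at_def)
    consider (even1) "c" "even (trailing_zeros u)"
      | (odd1) "c" "odd (trailing_zeros u)" | (odd0) "\<not> c" "odd (trailing_zeros u)"
      using ev by (auto split: if_splits)
    then show ?thesis
    proof cases
      case even1
      have last: "fin_act s (zeros k) = fin_act s (zeros n) @ [True]"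
        using s unfolding k fin_act_zeros_Suc by (simp add: gen_at_Suc)
      have img: "fin_act s ?base = fin_act s (zeros k) @ [True]"
        using s by (simp add: fin_act_append_carry fin_act_1)
      have "(u, fin_act s (zeros k)) \<in> (nonzero_step k)\<^sup>*"
        using len False even1 last k by (intro Suc.IH) auto
      then have "(u @ [c], fin_act s ?base) \<in> ?R"
        using even1 nonzero_path_snoc img by metis
      moreover have "(?base, fin_act s ?base) \<in> ?R"
        unfolding img by (rule nonzero_step_fin_act[of ?base "Suc k" s, unfolded img]) auto
      ultimately show ?thesis by (meson nonzero_path_sym rtrancl_trans)
    next
      case odd1
      have "k \<noteq> 1"
      proof
        assume "k = 1"
        then obtain z where "u = [z]" using len by (cases u) auto
        then show False using odd1 False \<open>k = 1\<close> zeros_Suc[of 0]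
          trailing_zeros_snoc[of "[]" z] by (auto split: if_splits)
      qed
      then obtain m where m: "k = Suc (Suc m)" using k by (cases n) auto
      define v where "v = (if even k then True # zeros (Suc m) else False # True # zeros m)"
      have v: "length v = k" "v \<noteq> zeros k" "odd (trailing_zeros v)" "fin_act (other s) v = zeros k"
        using trailing_zeros_last_one[of "[]" "Suc m"] trailing_zeros_last_one[of "[False]" m]
        by (auto simp: v_def m zeros_Suc s_def gen_at_def fin_act_0 fin_act_1)
      have img: "fin_act (other s) (v @ [True]) = ?base"
        using v by (simp add: fin_act_append_no_carry)
      have "(u, v) \<in> (nonzero_step k)\<^sup>*"
        using len False odd1 v by (intro Suc.IH) auto
      then have "(u @ [c], v @ [True]) \<in> ?R"
        using odd1 nonzero_path_snoc by metis
      moreover have "(v @ [True], ?base) \<in> ?R"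
        using nonzero_step_fin_act[of "v @ [True]" "Suc k" "other s"] v img by simp
      ultimately show ?thesis by (rule rtrancl_trans)
    next
      case odd0
      have "k \<noteq> 1"
      proof
        assume "k = 1"
        then obtain z where "u = [z]" using len by (cases u) auto
        then show False using odd0 False \<open>k = 1\<close> zeros_Suc[of 0]
          trailing_zeros_snoc[of "[]" z] by (auto split: if_splits)
      qed
      then obtain m where m: "k = Suc (Suc m)" using k by (cases n) auto
      have "fin_act (other s) (zeros k) ! m"
        using s by (simp add: nth_fin_act_zeros m gen_at_Suc)
      then have nz: "fin_act (other s) (zeros k) \<noteq> zeros k"
        using m by auto
      have odd: "odd (trailing_zeros (fin_act (other s) (zeros k)))"
        using fin_act_zeros_branch[of k "other s"] s nz k by (auto simp: branch_def)
      have img: "fin_act (other s) ?base = fin_act (other s) (zeros k) @ [False]"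
        using s by (simp add: fin_act_append_carry fin_act_1)
      have "(u, fin_act (other s) (zeros k)) \<in> (nonzero_step k)\<^sup>*"
        using len False odd0 nz odd by (intro Suc.IH) auto
      then have "(u @ [c], fin_act (other s) ?base) \<in> ?R"
        using odd0 nonzero_path_snoc img by metis
      moreover have "(?base, fin_act (other s) ?base) \<in> ?R"
        by (rule nonzero_step_fin_act) (auto simp: img nz)
      ultimately show ?thesis by (meson nonzero_path_sym rtrancl_trans)
    qed
  qed
  obtain u c where x: "x = u @ [c]" using Suc.prems(1) by (cases x rule: rev_cases) auto
  obtain u' c' where y: "y = u' @ [c']" using Suc.prems(3) by (cases y rule: rev_cases) auto
  show ?case
  proof (cases "even (trailing_zeros x)")
    case True
    then have "(x, ?base) \<in> ?R" "(y, ?base) \<in> ?R"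
      using Suc.prems to_base x y by auto
    then show ?thesis by (meson nonzero_path_sym rtrancl_trans)
  next
    case False
    then have "\<not> c" "\<not> c'" "even (trailing_zeros u)" "even (trailing_zeros u')"
      using Suc.prems x y by (auto split: if_splits)
    then have "(u, u') \<in> (nonzero_step k)\<^sup>*"
      using Suc.prems x y by (intro Suc.IH) auto
    then show ?thesis
      using nonzero_path_snoc[of u u' k False] \<open>\<not> c\<close> \<open>\<not> c'\<close> x y by simp
  qed
qed simp

lemma nonzero_path_same_side:
  assumes "(x, y) \<in> (nonzero_step k)\<^sup>*" "length x = k" "x \<noteq> zeros k"
  shows "length y = k \<and> y \<noteq> zeros k \<and> even (trailing_zeros y) = even (trailing_zeros x)"
  using assms
proof (induction rule: rtrancl_induct)
  case (step y z)
  obtain s where "length z = k" "z \<noteq> zeros k" "z = fin_act s y \<or> y = fin_act s z"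
    using step.hyps by (auto simp: nonzero_step_def)
  then show ?case
    using step fin_act_trailing_zeros[of y s] fin_act_trailing_zeros[of z s] by auto
qed simp

text \<open>The two components left after removing the zero word are its two sides, so the one that is
  attached in a decoration is the odd side.\<close>

lemma odd_component:
  assumes "k \<ge> 2"
  shows "(THE U. U \<in> components (induced (Gamma_fin k) (verts (Gamma_fin k) - {zeros k})) \<and>
      zeros (k - 1) @ [True] \<notin> U) = branch k - {zeros k}"
proof -
  let ?t = "zeros (k - 1) @ [True]"
  have comps: "components (induced (Gamma_fin k) (verts (Gamma_fin k) - {zeros k})) =
      {{y. (x, y) \<in> (nonzero_step k)\<^sup>*} | x. length x = k \<and> x \<noteq> zeros k}"
    unfolding components_def adj_minus_zeros
    by (auto simp: induced_def Gamma_fin_def schreier_def)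
  have t: "length ?t = k" "?t \<noteq> zeros k" "even (trailing_zeros ?t)"
    using assms by auto
  have side: "{y. (x, y) \<in> (nonzero_step k)\<^sup>*} = branch k - {zeros k}"
    if "length x = k" "x \<noteq> zeros k" "odd (trailing_zeros x)" for x
    using nonzero_path_same_side[of x _ k] same_side_connected[of x k] that
    by (auto simp: branch_def)
  obtain m where k: "k = Suc (Suc m)"
    using assms by (metis add_2_eq_Suc less_eqE)
  define x0 where "x0 = zeros m @ [True, False]"
  have x0: "length x0 = k" "x0 \<noteq> zeros k" "odd (trailing_zeros x0)"
    using trailing_zeros_last_one[of "zeros m" 1] last_one_neq_zeros[of "zeros m" "[False]" k]
    by (auto simp: x0_def k zeros_Suc)
  show ?thesis
  proof (rule the_equality)
    show "branch k - {zeros k} \<in> components (induced (Gamma_fin k) (verts (Gamma_fin k) - {zeros k})) \<and>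
        ?t \<notin> branch k - {zeros k}"
      unfolding comps using side[OF x0] x0 by (auto simp: branch_def)
  next
    fix U
    assume U: "U \<in> components (induced (Gamma_fin k) (verts (Gamma_fin k) - {zeros k})) \<and> ?t \<notin> U"
    then obtain x where x: "U = {y. (x, y) \<in> (nonzero_step k)\<^sup>*}" "length x = k" "x \<noteq> zeros k"
      unfolding comps by auto
    then have "odd (trailing_zeros x)"
      using U t same_side_connected[of x k ?t] by auto
    then show "U = branch k - {zeros k}" using x side by simp
  qed
qed

text \<open>A generator leads out of a decoration only from its root, namely when it would act as
  \<^term>\<open>Gen_a\<close> after the last letter: then it acts on the last letter as \<^term>\<open>Gen_b\<close> and turns it
  into 1.\<close>

lemma decoration_eq:
  assumes "k \<ge> 1"
  shows verts_decoration: "verts (decoration k) = branch k"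
    and edges_decoration: "edges (decoration k) =
      {(w, s). w \<in> branch k \<and> \<not> (w = zeros k \<and> gen_at s k = Gen_a)}"
    and ends_decoration: "(w, s) \<in> edges (decoration k) \<Longrightarrow>
      ends (decoration k) (w, s) = Upair w (fin_act s w)"
proof -
  have "verts (decoration k) = branch k \<and>
    edges (decoration k) = {(w, s). w \<in> branch k \<and> \<not> (w = zeros k \<and> gen_at s k = Gen_a)} \<and>
    (\<forall>w s. (w, s) \<in> edges (decoration k) \<longrightarrow>
      ends (decoration k) (w, s) = Upair w (fin_act s w))"
  proof (cases "k = 1")
    case True
    have "branch 1 = {zeros 1}"
    proof -
      have "w = zeros 1" if "w \<in> branch 1" for w
      proof -
        have "length w = 1" using that by (simp add: branch_def)
        then obtain z where "w = [z]" by (cases w) auto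
        then show ?thesis
          using that trailing_zeros_snoc[of "[]" z] by (auto simp: branch_def zeros_Suc)
      qed
      then show ?thesis using zeros_in_branch by blast
    qed
    moreover have "decoration 1 = \<lparr>verts = {zeros 1}, edges = {(zeros 1, Gen_a)},
        ends = (\<lambda>_. Upair (zeros 1) (zeros 1))\<rparr>"
      by (simp add: decoration_def)
    moreover have "gen_at s 1 = Gen_a \<longleftrightarrow> s = Gen_b" for s
      by (cases s) (auto simp: gen_at_def)
    moreover have "fin_act Gen_a (zeros 1) = zeros 1"
      by (simp add: zeros_Suc)
    ultimately show ?thesis
      unfolding True by (auto simp del: One_nat_def fin_act.simps)
  next
    case False
    then have k: "k \<ge> 2" using assms by simp
    have ins: "insert (zeros k) (branch k - {zeros k}) = branch k"
      by auto
    have dec: "decoration k = induced (Gamma_fin k) (branch k)"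
      using False unfolding decoration_def odd_component[OF k] ins by simp
    have step: "fin_act s w \<in> branch k \<longleftrightarrow> \<not> (w = zeros k \<and> gen_at s k = Gen_a)"
      if "w \<in> branch k" for w s
      using fin_act_branch[OF that, of s] fin_act_zeros_branch[OF assms, of s]
      by (cases "gen_at s k") auto
    have len: "branch k \<subseteq> {w. length w = k}"
      by (auto simp: branch_def)
    have "verts (decoration k) = branch k"
      unfolding dec using len by (auto simp: induced_def Gamma_fin_def schreier_def)
    moreover have "edges (decoration k) =
        {(w, s). w \<in> branch k \<and> fin_act s w \<in> branch k}"
      unfolding dec using len by (auto simp: induced_def Gamma_fin_def schreier_def)
    moreover have "\<dots> = {(w, s). w \<in> branch k \<and> \<not> (w = zeros k \<and> gen_at s k = Gen_a)}"
      using step by blast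
    moreover have "ends (decoration k) (w, s) = Upair w (fin_act s w)" for w s
      unfolding dec by (simp add: induced_def Gamma_fin_def schreier_def)
    ultimately show ?thesis by simp
  qed
  then show "verts (decoration k) = branch k"
    "edges (decoration k) = {(w, s). w \<in> branch k \<and> \<not> (w = zeros k \<and> gen_at s k = Gen_a)}"
    "(w, s) \<in> edges (decoration k) \<Longrightarrow> ends (decoration k) (w, s) = Upair w (fin_act s w)"
    by blast+
qed


section \<open>Orbits of the Basilica group\<close>

text \<open>Undirected paths of generator edges. They stay inside an orbit, since the group contains the
  inverses of the generators.\<close>

definition gen_step :: "(bool stream \<times> bool stream) set" where
  "gen_step = {(x, y). \<exists>s. y = inf_act s x \<or> x = inf_act s y}"

lemma inf_act_in_carrier: "inf_act s \<in> carrier (BijGroup UNIV)"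
  using generators_in_BijGroup by (cases s) auto

lemma inv_inf_act_group: "inv\<^bsub>BijGroup UNIV\<^esub> (inf_act s) = inv_act s"
proof -
  have "inf_act s \<in> Bij UNIV"
    using inf_act_in_carrier by (simp add: BijGroup_def)
  moreover have "inv_into UNIV (inf_act s) = inv_act s"
    by (rule inv_equality) (rule inv_inf_act inf_inv_act)+
  ultimately show ?thesis
    by (simp add: inv_BijGroup restrict_def)
qed

lemma basilica_mult:
  assumes "g \<in> basilica" "h \<in> basilica"
  shows "g \<otimes>\<^bsub>BijGroup UNIV\<^esub> h = g \<circ> h"
proof -
  have "basilica \<subseteq> carrier (BijGroup UNIV)"
    unfolding basilica_def
    by (rule group.generate_incl[OF group_BijGroup generators_in_BijGroup])
  then show ?thesis
    using assms by (auto simp: BijGroup_def compose_def o_def restrict_def)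
qed

lemma basilica_compose:
  assumes "g \<in> basilica" "h \<in> basilica"
  shows "g \<circ> h \<in> basilica"
  using assms generate.eng[of g "BijGroup UNIV" "{inf_a, inf_b}" h] basilica_mult[OF assms]
  unfolding basilica_def by simp

lemma inf_act_basilica: "inf_act s \<in> basilica"
  unfolding basilica_def by (cases s) (auto intro: generate.incl)

lemma inv_act_basilica: "inv_act s \<in> basilica"
proof -
  have "inf_act s \<in> {inf_a, inf_b}" by (cases s) auto
  then have "inv\<^bsub>BijGroup UNIV\<^esub> (inf_act s) \<in> basilica"
    unfolding basilica_def by (rule generate.inv)
  then show ?thesis by (simp add: inv_inf_act_group)
qed

lemma basilica_induct:
  assumes "g \<in> basilica" and "P \<xi>"
    and "\<And>s x. P x \<Longrightarrow> P (inf_act s x)" "\<And>s x. P x \<Longrightarrow> P (inv_act s x)"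
  shows "P (g \<xi>)"
proof -
  have "\<forall>x. P x \<longrightarrow> P (g x)"
    using assms(1) unfolding basilica_def
  proof (induction rule: generate.induct)
    case one
    then show ?case by (simp add: BijGroup_def)
  next
    case (incl h)
    then show ?case using assms(3) by auto
  next
    case (inv h)
    then show ?case using assms(4) by (auto simp: inv_inf_act_group)
  next
    case (eng h1 h2)
    then have "h1 \<otimes>\<^bsub>BijGroup UNIV\<^esub> h2 = h1 \<circ> h2"
      using basilica_mult unfolding basilica_def by blast
    then show ?case using eng by auto
  qed
  then show ?thesis using assms(2) by blast
qed

lemma gen_path_in_orbit:
  assumes "(\<xi>, v) \<in> gen_step\<^sup>*"
  shows "v \<in> basilica_orbit \<xi>"
  using assms
proof (induction rule: rtrancl_induct)
  case base
  have "(\<lambda>x. x) \<in> basilica"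
    using generate.one[of "BijGroup UNIV" "{inf_a, inf_b}"]
    by (simp add: basilica_def BijGroup_def restrict_def)
  then show ?case by (force simp: basilica_orbit_def)
next
  case (step y z)
  obtain g where g: "g \<in> basilica" "y = g \<xi>"
    using step.IH by (auto simp: basilica_orbit_def)
  obtain h where h: "h \<in> basilica" "z = h y"
  proof -
    obtain s where "z = inf_act s y \<or> z = inv_act s y"
      using step.hyps(2) unfolding gen_step_def by clarsimp (metis inv_inf_act)
    then show ?thesis using that inf_act_basilica inv_act_basilica by blast
  qed
  have "z = (h \<circ> g) \<xi>" using g h by simp
  then show ?case using basilica_compose[OF h(1) g(1)] unfolding basilica_orbit_def by blast
qed

text \<open>The action is self-replicating: an edge labelled \<^term>\<open>Gen_b\<close> lifts to an edge between the
  words with a 0 in front, and an edge labelled \<^term>\<open>Gen_a\<close> lifts to a path of length two. As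
  \<^term>\<open>Gen_b\<close> also exchanges the two possible first letters, any letters may be put in front.\<close>

lemma gen_path_SCons:
  assumes "(v, w) \<in> gen_step\<^sup>*"
  shows "(x ## v, y ## w) \<in> gen_step\<^sup>*"
proof -
  have sym: "sym (gen_step\<^sup>*)"
    by (intro sym_rtrancl) (auto simp: gen_step_def sym_def)
  have edge: "(u, inf_act s u) \<in> gen_step\<^sup>*" for u s
    by (auto simp: gen_step_def)
  have lift: "(False ## u, False ## inf_act s u) \<in> gen_step\<^sup>*" for u s
  proof (cases s)
    case Gen_a
    have "inf_b (inf_b (False ## u)) = False ## inf_act s u"
      using Gen_a by (simp add: inf_b_SCons)
    then show ?thesis
      using edge[of "False ## u" Gen_b] edge[of "inf_b (False ## u)" Gen_b]
      by (metis rtrancl_trans)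
  next
    case Gen_b
    then show ?thesis using edge[of "False ## u" Gen_a] by (simp add: inf_a_SCons)
  qed
  have zero: "(False ## v, False ## w) \<in> gen_step\<^sup>*"
    using assms
  proof (induction rule: rtrancl_induct)
    case (step u u')
    then have "(False ## u, False ## u') \<in> gen_step\<^sup>*"
      using lift symD[OF sym lift] by (auto simp: gen_step_def)
    with step.IH show ?case by (rule rtrancl_trans)
  qed simp
  have to_zero: "(z ## u, False ## u) \<in> gen_step\<^sup>*" for z u
    using edge[of "z ## u" Gen_b] by (cases z) (auto simp: inf_b_SCons)
  show ?thesis
    using to_zero[of x v] zero symD[OF sym to_zero[of y w]] by (meson rtrancl_trans)
qed

definition cofinal :: "bool stream \<Rightarrow> bool stream \<Rightarrow> bool" where
  "cofinal v w \<longleftrightarrow> (\<exists>n. \<forall>j\<ge>n. v !! j = w !! j)"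

lemma cofinal_refl [simp]: "cofinal v v"
  by (simp add: cofinal_def)

lemma cofinal_sym: "cofinal v w \<Longrightarrow> cofinal w v"
  by (auto simp: cofinal_def)

lemma cofinal_trans: "cofinal u v \<Longrightarrow> cofinal v w \<Longrightarrow> cofinal u w"
  unfolding cofinal_def by (metis linorder_le_cases order_trans)

lemma stream_eqI: "(\<And>j. v !! j = w !! j) \<Longrightarrow> v = w"
  by (metis (mono_tags) smap_alt stream.map_ident)

lemma cofinal_shift:
  assumes "length u = length v"
  shows "cofinal (u @- w) (v @- w)"
  unfolding cofinal_def using assms by (intro exI[of _ "length u"]) (simp add: shift_snth)

lemma cofinal_gen_path:
  assumes "\<forall>j\<ge>n. v !! j = w !! j"
  shows "(v, w) \<in> gen_step\<^sup>*"
  using assms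
proof (induction n arbitrary: v w)
  case 0
  then have "v = w" by (auto intro: stream_eqI)
  then show ?case by simp
next
  case (Suc n)
  have "stl v !! j = stl w !! j" if "j \<ge> n" for j
    using Suc.prems that by (metis Suc_le_mono snth.simps(2))
  then have "(shd v ## stl v, shd w ## stl w) \<in> gen_step\<^sup>*"
    by (intro gen_path_SCons Suc.IH) simp
  then show ?case by simp
qed

text \<open>A generator changes infinitely many letters of the word \<open>000...\<close> and finitely many letters of
  any other word.\<close>

lemma split_first_one:
  assumes "v !! i"
  obtains n w where "v = zeros n @- True ## w"
proof -
  have "\<exists>n w. v = zeros n @- True ## w"
    using assms
  proof (induction i arbitrary: v)
    case 0
    then show ?case by (intro exI[of _ 0] exI[of _ "stl v"]) (auto intro: stream.expand)
  next
    case (Suc i)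
    then have "stl v !! i" by simp
    then obtain n w where v: "stl v = zeros n @- True ## w" using Suc.IH by blast
    show ?case
    proof (cases "shd v")
      case True
      then show ?thesis by (intro exI[of _ 0] exI[of _ "stl v"]) (auto intro: stream.expand)
    next
      case False
      then show ?thesis using v
        by (intro exI[of _ "Suc n"] exI[of _ w]) (auto simp: zeros_Suc intro: stream.expand)
    qed
  qed
  then show ?thesis using that by blast
qed

lemma cofinal_inf_act:
  assumes "v !! i"
  shows "cofinal (inf_act s v) v"
proof -
  obtain n w where v: "v = zeros n @- True ## w" using assms by (rule split_first_one)
  have "inf_act s v = (fin_act s (zeros n) @ [gen_at s n = Gen_a]) @- w"
    by (simp add: v inf_act_shift_carry inf_act_1)
  moreover have "v = (zeros n @ [True]) @- w" by (simp add: v)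
  ultimately show ?thesis by (metis cofinal_shift length_append_singleton length_fin_act)
qed

lemma inf_act_all_zero:
  assumes "\<And>i. \<not> v !! i"
  shows "inf_act s v !! j \<longleftrightarrow> gen_at s j = Gen_b"
proof -
  have "stake n v = zeros n" for n
    using assms by (intro nth_equalityI) auto
  then have "v = zeros (Suc j) @- sdrop (Suc j) v"
    by (metis stake_sdrop)
  then have "inf_act s v !! j = fin_act s (zeros (Suc j)) ! j"
    by (metis inf_act_shift_carry length_fin_act length_zeros lessI shift_snth_less)
  then show ?thesis by (simp add: nth_fin_act_zeros)
qed


section \<open>The main line as an odometer\<close>

text \<open>Both halves of \<^term>\<open>E2\<close> are treated together. The letters of \<^term>\<open>\<xi>\<close> at the indices
  \<^term>\<open>j\<close> with \<^term>\<open>even (j + e)\<close> (frozen indices) are eventually 0, the letters at the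
  other indices \<^term>\<open>2 * k + e - 1\<close> (digit indices) are not eventually constant, and
  \<^term>\<open>c\<close> is the generator that acts as \<^term>\<open>Gen_b\<close> at the digit indices. As indices of streams
  start at 0, the decoration of size \<^term>\<open>2 * k + e\<close> belongs to the words in which the first 1 at a
  digit index is at the index \<^term>\<open>2 * k + e - 1\<close>.\<close>

locale two_ended =
  fixes \<xi> :: "bool stream" and c :: gen and e :: nat
  assumes c_e: "c = Gen_a \<and> e = 2 \<or> c = Gen_b \<and> e = 1"
    and frozen_ends: "\<exists>N. \<forall>j\<ge>N. even (j + e) \<longrightarrow> \<not> \<xi> !! j"
    and digit_ones: "\<exists>k\<ge>N. \<xi> !! (2 * k + e - 1)"
    and digit_zeros: "\<exists>k\<ge>N. \<not> \<xi> !! (2 * k + e - 1)"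
begin

definition dsize :: "nat \<Rightarrow> nat" where
  "dsize k = 2 * k + e"

definition dig :: "nat \<Rightarrow> nat" where
  "dig k = 2 * k + e - 1"

definition frozen :: "nat \<Rightarrow> bool" where
  "frozen j \<longleftrightarrow> even (j + e)"

lemma dsize_dig: "dsize k = Suc (dig k)"
  using c_e by (auto simp: dsize_def dig_def)

lemma dig_less_iff [simp]: "dig i < dig k \<longleftrightarrow> i < k"
  using c_e by (auto simp: dig_def)

lemma dig_eq_iff [simp]: "dig i = dig k \<longleftrightarrow> i = k"
  using c_e by (auto simp: dig_def)

lemma le_dig: "k \<le> dig k"
  using c_e by (auto simp: dig_def)

lemma not_frozen_dig [simp]: "\<not> frozen (dig k)"
  using c_e by (auto simp: dig_def frozen_def)

lemma frozen_dsize [simp]: "frozen (dsize k)"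
  by (simp add: dsize_def frozen_def)

lemma dig_cases:
  assumes "\<not> frozen j"
  obtains k where "j = dig k"
proof -
  have "j = dig (j div 2)"
    using c_e
  proof
    assume "c = Gen_a \<and> e = 2"
    then show ?thesis using assms unfolding dig_def frozen_def by presburger
  next
    assume "c = Gen_b \<and> e = 1"
    then show ?thesis using assms unfolding dig_def frozen_def by presburger
  qed
  then show ?thesis using that by blast
qed

lemma gen_at_c: "gen_at c j = Gen_b \<longleftrightarrow> \<not> frozen j"
  using c_e by (auto simp: gen_at_def frozen_def)

lemma gen_at_dig: "gen_at c (dig k) = Gen_b"
  by (simp add: gen_at_c)

lemma gen_at_Gen_b_other: "s \<noteq> c \<Longrightarrow> gen_at s j = Gen_b \<longleftrightarrow> frozen j"
  unfolding gen_at_def frozen_def using c_e by (cases s) auto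

definition cls :: "bool stream set" where
  "cls = {v. cofinal v \<xi>}"

lemma cls_frozen: "v \<in> cls \<Longrightarrow> \<exists>N. \<forall>j\<ge>N. frozen j \<longrightarrow> \<not> v !! j"
  using frozen_ends unfolding cls_def cofinal_def frozen_def
  by clarsimp (metis le_trans nat_le_linear)

lemma cls_dig_eq:
  assumes "v \<in> cls"
  shows "\<exists>N. \<forall>k\<ge>N. v !! dig k = \<xi> !! dig k"
  using assms le_dig unfolding cls_def cofinal_def by (auto intro: order_trans)

lemma cls_digit_one:
  assumes "v \<in> cls"
  shows "\<exists>k\<ge>N. v !! dig k"
proof -
  obtain M where M: "\<forall>k\<ge>M. v !! dig k = \<xi> !! dig k"
    using cls_dig_eq[OF assms] by blast
  obtain k where "k \<ge> max M N" "\<xi> !! dig k"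
    using digit_ones[of "max M N"] by (auto simp: dig_def)
  then show ?thesis using M by auto
qed

lemma cls_digit_zero:
  assumes "v \<in> cls"
  shows "\<exists>k\<ge>N. \<not> v !! dig k"
proof -
  obtain M where M: "\<forall>k\<ge>M. v !! dig k = \<xi> !! dig k"
    using cls_dig_eq[OF assms] by blast
  obtain k where "k \<ge> max M N" "\<not> \<xi> !! dig k"
    using digit_zeros[of "max M N"] by (auto simp: dig_def)
  then show ?thesis using M by auto
qed

lemma cls_cofinal: "v \<in> cls \<Longrightarrow> cofinal w v \<Longrightarrow> w \<in> cls"
  unfolding cls_def using cofinal_trans by blast

lemma cls_inf_act: "v \<in> cls \<Longrightarrow> inf_act s v \<in> cls"
  using cls_digit_one[of v 0] cofinal_inf_act cls_cofinal by blast

text \<open>Infinitely many letters change only between the word \<open>000...\<close> and its images \<open>0101...\<close> and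
  \<open>1010...\<close>. These images are not in the class, since in them the digits are all 1 or the frozen
  letters are all 1.\<close>

lemma cls_inv_act:
  assumes "v \<in> cls"
  shows "inv_act s v \<in> cls"
proof -
  define u where "u = inv_act s v"
  have v: "v = inf_act s u" by (simp add: u_def inf_inv_act)
  have "\<exists>i. u !! i"
  proof (rule ccontr)
    assume "\<nexists>i. u !! i"
    then have dig: "v !! j \<longleftrightarrow> gen_at s j = Gen_b" for j
      unfolding v using inf_act_all_zero by blast
    show False
    proof (cases "s = c")
      case True
      then show False using dig gen_at_dig cls_digit_zero[OF assms, of 0] by auto
    next
      case False
      then have "v !! dsize k" for k
        using dig gen_at_Gen_b_other by simp
      moreover obtain N where "\<forall>j\<ge>N. frozen j \<longrightarrow> \<not> v !! j"
        using cls_frozen[OF assms] by blast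
      moreover have "dsize N \<ge> N" by (simp add: dsize_def)
      ultimately show False using frozen_dsize by blast
    qed
  qed
  then have "cofinal u v" unfolding v using cofinal_inf_act cofinal_sym by blast
  then show ?thesis using assms cls_cofinal u_def by blast
qed

lemma basilica_orbit_eq: "basilica_orbit \<xi> = cls"
proof
  show "basilica_orbit \<xi> \<subseteq> cls"
    unfolding basilica_orbit_def
    using basilica_induct[of _ "\<lambda>v. v \<in> cls" \<xi>] cls_inf_act cls_inv_act by (auto simp: cls_def)
  show "cls \<subseteq> basilica_orbit \<xi>"
  proof
    fix v assume "v \<in> cls"
    then obtain n where "\<forall>j\<ge>n. \<xi> !! j = v !! j" by (auto simp: cls_def cofinal_def)
    then show "v \<in> basilica_orbit \<xi>" by (intro gen_path_in_orbit cofinal_gen_path)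
  qed
qed

text \<open>The main line: it becomes the bi-infinite path, whose edges are the edges labelled
  \<^term>\<open>c\<close>.\<close>

definition main :: "bool stream set" where
  "main = {v \<in> cls. \<forall>j. frozen j \<longrightarrow> \<not> v !! j}"

definition lead :: "bool stream \<Rightarrow> nat" where
  "lead r = (LEAST k. r !! dig k)"

lemma main_cls: "r \<in> main \<Longrightarrow> r \<in> cls"
  by (simp add: main_def)

lemma lead_digit: "r \<in> main \<Longrightarrow> r !! dig (lead r)"
  unfolding lead_def using cls_digit_one[of r 0] main_cls by (auto intro: LeastI)

lemma before_lead:
  assumes "r \<in> main" "j < dig (lead r)"
  shows "\<not> r !! j"
proof (cases "frozen j")
  case True
  then show ?thesis using assms by (auto simp: main_def)
next
  case False
  then obtain k where "j = dig k" by (rule dig_cases)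
  then show ?thesis using assms not_less_Least[of k "\<lambda>k. r !! dig k"] by (auto simp: lead_def)
qed

lemma stake_eq_zeros: "(\<And>j. j < n \<Longrightarrow> \<not> v !! j) \<Longrightarrow> stake n v = zeros n"
  by (intro nth_equalityI) auto

lemma main_split:
  assumes "r \<in> main"
  shows "r = zeros (dig (lead r)) @- True ## sdrop (dsize (lead r)) r"
proof -
  let ?n = "dig (lead r)"
  have "r = stake ?n r @- r !! ?n ## sdrop (Suc ?n) r"
    by (metis id_stake_snth_sdrop)
  moreover have "stake ?n r = zeros ?n"
    using before_lead[OF assms] by (rule stake_eq_zeros)
  ultimately show ?thesis using lead_digit[OF assms] by (simp add: dsize_dig)
qed

lemma lead_eq:
  assumes "r = zeros (dig k) @- True ## w"
  shows "lead r = k"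
  unfolding lead_def
proof (rule Least_equality)
  show "r !! dig k" by (simp add: assms)
  fix i assume "r !! dig i"
  then show "k \<le> i"
    using dig_less_iff[of i k] unfolding assms by (auto simp: shift_snth split: if_splits)
qed

lemma main_act_c:
  assumes "r \<in> main"
  shows "inf_act c r = fin_act c (zeros (dig (lead r))) @- False ## sdrop (dsize (lead r)) r"
  by (subst main_split[OF assms])
    (simp add: inf_act_shift_carry inf_act_1 gen_at_dig)

lemma main_act_c_snth:
  assumes "r \<in> main"
  shows "inf_act c r !! j =
    (if j < dig (lead r) then \<not> frozen j else j \<noteq> dig (lead r) \<and> r !! j)"
proof -
  let ?n = "dig (lead r)"
  consider "j < ?n" | "j = ?n" | i where "j = Suc ?n + i"
    by (metis add_Suc less_imp_Suc_add not_less_iff_gr_or_eq)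
  then show ?thesis
  proof cases
    case 1
    then show ?thesis
      by (simp add: main_act_c[OF assms] nth_fin_act_zeros gen_at_c)
  next
    case 2
    then show ?thesis by (simp add: main_act_c[OF assms])
  next
    case 3
    have "inf_act c r !! j = (False ## sdrop (Suc ?n) r) !! Suc i"
      unfolding main_act_c[OF assms] 3 dsize_dig by (simp add: shift_snth del: snth.simps sdrop.simps)
    then show ?thesis using 3 by (simp add: sdrop_snth add.commute del: sdrop.simps)
  qed
qed

lemma main_act_c_in_main: "r \<in> main \<Longrightarrow> inf_act c r \<in> main"
  using cls_inf_act by (auto simp: main_def main_act_c_snth)

end


section \<open>Coordinates on the main line\<close>

definition bin :: "(nat \<Rightarrow> bool) \<Rightarrow> nat \<Rightarrow> int" where
  "bin f N = (\<Sum>i<N. 2 ^ i * of_bool (f i))"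

lemma bin_0 [simp]: "bin f 0 = 0"
  by (simp add: bin_def)

lemma bin_Suc: "bin f (Suc N) = bin f N + 2 ^ N * of_bool (f N)"
  by (simp add: bin_def)

lemma bin_bounds: "0 \<le> bin f N \<and> bin f N < 2 ^ N"
  by (induction N) (auto simp: bin_Suc)

lemma bin_cong: "(\<And>i. i < N \<Longrightarrow> f i = g i) \<Longrightarrow> bin f N = bin g N"
  by (simp add: bin_def)

lemma bin_inj:
  assumes "bin f N = bin g N" "i < N"
  shows "f i = g i"
  using assms
proof (induction N)
  case (Suc N)
  have "f N = g N"
    using Suc.prems(1) bin_bounds[of f N] bin_bounds[of g N]
    by (auto simp: bin_Suc of_bool_def split: if_splits)
  then show ?case using Suc by (auto simp: bin_Suc less_Suc_eq)
qed simp

lemma bin_cong_mod: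
  assumes "M \<le> N"
  shows "[bin f N = bin f M] (mod 2 ^ M)"
  using assms
proof (induction N rule: dec_induct)
  case (step N)
  have "(2 :: int) ^ M dvd 2 ^ N * of_bool (f N)"
    using step.hyps by (simp add: le_imp_power_dvd)
  then have "[2 ^ N * of_bool (f N) = (0 :: int)] (mod 2 ^ M)"
    by (simp add: cong_0_iff)
  then show ?case using step.IH cong_add by (fastforce simp: bin_Suc)
qed simp

lemma bin_diff:
  assumes "\<And>i. i \<ge> M \<Longrightarrow> f i = g i" "M \<le> N"
  shows "bin f N - bin g N = bin f M - bin g M"
  using assms(2)
proof (induction N rule: dec_induct)
  case (step N)
  then show ?case using assms(1)[of N] by (simp add: bin_Suc)
qed simp

lemma bin_all_ones: "(\<And>i. i < N \<Longrightarrow> f i) \<Longrightarrow> bin f N = 2 ^ N - 1"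
  by (induction N) (auto simp: bin_Suc)

lemma bin_all_zeros: "(\<And>i. i < N \<Longrightarrow> \<not> f i) \<Longrightarrow> bin f N = 0"
  by (simp add: bin_def)

lemma bin_first_one_iff:
  "[bin f (Suc k) = 2 ^ k] (mod 2 ^ Suc k) \<longleftrightarrow> f k \<and> (\<forall>i<k. \<not> f i)"
proof -
  let ?g = "\<lambda>i. i = k"
  have g: "bin ?g (Suc k) = 2 ^ k"
    by (simp add: bin_Suc bin_all_zeros)
  have "[bin f (Suc k) = bin ?g (Suc k)] (mod 2 ^ Suc k) \<longleftrightarrow> bin f (Suc k) = bin ?g (Suc k)"
    using bin_bounds[of f "Suc k"] bin_bounds[of ?g "Suc k"] by (simp add: cong_def)
  also have "\<dots> \<longleftrightarrow> (\<forall>i<Suc k. f i = ?g i)"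
    using bin_inj[of f "Suc k" ?g] bin_cong[of "Suc k" f ?g] by blast
  also have "\<dots> \<longleftrightarrow> f k \<and> (\<forall>i<k. \<not> f i)"
    by (auto simp: less_Suc_eq)
  finally show ?thesis by (simp only: g)
qed


lemma A'_iff:
  "n \<in> A' \<gamma> k \<longleftrightarrow>
    [n = 2 ^ k - 1 - (\<Sum>i=1..k. 2 ^ i * of_bool (\<gamma> (i + 1)))] (mod 2 ^ Suc k)"
  by (cases "k = 0") (auto simp: A'_def cong_0_iff)

context two_ended
begin

text \<open>The digits of a word in the class form a 2-adic integer. Its difference to the 2-adic integer of
  \<^term>\<open>\<xi>\<close> is an integer, and this difference is the coordinate, up to the shift
  that turns the classes of coordinates with a given first digit 1 into the sets
  \<^term>\<open>A' \<gamma> k\<close>.\<close>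

definition pos :: "bool stream \<Rightarrow> int" where
  "pos v = (let N = (LEAST N. \<forall>k\<ge>N. v !! dig k = \<xi> !! dig k) in
    of_bool (\<xi> !! dig 0) - 1 + bin (\<lambda>i. v !! dig i) N - bin (\<lambda>i. \<xi> !! dig i) N)"

lemma pos_eq:
  assumes "\<forall>k\<ge>N. v !! dig k = \<xi> !! dig k"
  shows "pos v = of_bool (\<xi> !! dig 0) - 1 + bin (\<lambda>i. v !! dig i) N - bin (\<lambda>i. \<xi> !! dig i) N"
proof -
  let ?P = "\<lambda>N. \<forall>k\<ge>N. v !! dig k = \<xi> !! dig k"
  define L where "L = Least ?P"
  have L: "?P L" unfolding L_def using assms by (rule LeastI)
  have "L \<le> N" unfolding L_def using assms by (rule Least_le)
  then have "bin (\<lambda>i. v !! dig i) N - bin (\<lambda>i. \<xi> !! dig i) N =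
      bin (\<lambda>i. v !! dig i) L - bin (\<lambda>i. \<xi> !! dig i) L"
    using L by (intro bin_diff) auto
  then show ?thesis unfolding pos_def Let_def L_def[symmetric] by simp
qed

lemma pos_inj: "inj_on pos main"
proof (rule inj_onI)
  fix v w assume vw: "v \<in> main" "w \<in> main" "pos v = pos w"
  obtain M where M: "\<forall>k\<ge>M. v !! dig k = \<xi> !! dig k"
    using cls_dig_eq main_cls vw(1) by blast
  obtain N where N: "\<forall>k\<ge>N. w !! dig k = \<xi> !! dig k"
    using cls_dig_eq main_cls vw(2) by blast
  let ?L = "max M N"
  have "bin (\<lambda>i. v !! dig i) ?L = bin (\<lambda>i. w !! dig i) ?L"
    using vw(3) pos_eq[of ?L v] pos_eq[of ?L w] M N by simp
  then have "v !! dig i = w !! dig i" for i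
    using bin_inj[of "\<lambda>i. v !! dig i" ?L "\<lambda>i. w !! dig i" i] M N by (cases "i < ?L") auto
  then show "v = w"
    using vw by (intro stream_eqI) (metis (mono_tags, lifting) dig_cases main_def mem_Collect_eq)
qed

text \<open>The generator \<^term>\<open>c\<close> subtracts 1 with borrow, as it replaces leading digits
  \<open>0...01\<close> by \<open>1...10\<close>.\<close>

lemma pos_act_c:
  assumes "r \<in> main"
  shows "pos (inf_act c r) = pos r - 1"
proof -
  let ?k = "lead r"
  obtain M where M: "\<forall>k\<ge>M. r !! dig k = \<xi> !! dig k"
    using cls_dig_eq main_cls assms by blast
  let ?N = "max M (Suc ?k)"
  have above: "inf_act c r !! dig i = r !! dig i" if "i \<ge> Suc ?k" for i
    using that by (simp add: main_act_c_snth[OF assms])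
  have "bin (\<lambda>i. inf_act c r !! dig i) ?N - bin (\<lambda>i. r !! dig i) ?N =
      bin (\<lambda>i. inf_act c r !! dig i) (Suc ?k) - bin (\<lambda>i. r !! dig i) (Suc ?k)"
    using above by (intro bin_diff) auto
  also have "bin (\<lambda>i. inf_act c r !! dig i) (Suc ?k) = 2 ^ ?k - 1"
    by (simp add: bin_Suc bin_all_ones main_act_c_snth[OF assms])
  also have "bin (\<lambda>i. r !! dig i) (Suc ?k) = 2 ^ ?k"
    using before_lead[OF assms] lead_digit[OF assms] by (simp add: bin_Suc bin_all_zeros)
  finally have "bin (\<lambda>i. inf_act c r !! dig i) ?N = bin (\<lambda>i. r !! dig i) ?N - 1" by simp
  moreover have "\<forall>k\<ge>?N. inf_act c r !! dig k = \<xi> !! dig k" "\<forall>k\<ge>?N. r !! dig k = \<xi> !! dig k"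
    using above M by auto
  ultimately show ?thesis using pos_eq by presburger
qed

lemma main_nonempty: "main \<noteq> {}"
proof -
  define v where "v = smap (\<lambda>j. \<xi> !! j \<and> \<not> frozen j) nats"
  have v: "v !! j \<longleftrightarrow> \<xi> !! j \<and> \<not> frozen j" for j
    by (simp add: v_def)
  obtain N where "\<forall>j\<ge>N. frozen j \<longrightarrow> \<not> \<xi> !! j"
    using cls_frozen[of \<xi>] by (auto simp: cls_def)
  then have "v \<in> cls" using v by (auto simp: cls_def cofinal_def)
  then have "v \<in> main" using v by (simp add: main_def)
  then show ?thesis by blast
qed

text \<open>Adding 1 with carry replaces leading digits \<open>1...10\<close> by \<open>0...01\<close>.\<close>

lemma main_predecessor:
  assumes "r \<in> main"
  obtains r' where "r' \<in> main" "inf_act c r' = r"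
proof -
  define k where "k = (LEAST k. \<not> r !! dig k)"
  have "\<exists>k. \<not> r !! dig k"
    using cls_digit_zero[OF main_cls[OF assms], of 0] by blast
  then have k: "\<not> r !! dig k" unfolding k_def by (rule LeastI_ex)
  have less_k: "r !! dig i" if "i < k" for i
    using that not_less_Least unfolding k_def by blast
  define r' where "r' = zeros (dig k) @- True ## sdrop (dsize k) r"
  have r'_snth: "r' !! j \<longleftrightarrow> j = dig k \<or> dig k < j \<and> r !! j" for j
  proof -
    consider "j < dig k" | "j = dig k" | i where "j = Suc (dig k) + i"
      by (metis add_Suc less_imp_Suc_add not_less_iff_gr_or_eq)
    then show ?thesis
    proof cases
      case 3
      have "r' !! j = (True ## sdrop (Suc (dig k)) r) !! Suc i"
        unfolding r'_def 3 dsize_dig by (simp add: shift_snth del: snth.simps sdrop.simps)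
      then show ?thesis using 3 by (simp add: sdrop_snth add.commute del: sdrop.simps)
    qed (auto simp: r'_def)
  qed
  have "cofinal r' r"
    unfolding cofinal_def using r'_snth by (intro exI[of _ "dsize k"]) (auto simp: dsize_dig)
  then have "r' \<in> cls" using assms cls_cofinal main_cls by blast
  moreover have "\<not> r' !! j" if "frozen j" for j
    using that assms by (auto simp: r'_snth main_def)
  ultimately have "r' \<in> main" by (simp add: main_def)
  moreover have "inf_act c r' = r"
  proof (rule stream_eqI)
    fix j
    have "lead r' = k" using r'_def by (rule lead_eq)
    then have "inf_act c r' !! j = (if j < dig k then \<not> frozen j else j \<noteq> dig k \<and> r' !! j)"
      using main_act_c_snth[OF \<open>r' \<in> main\<close>] by simp
    moreover have "r !! j = (\<not> frozen j)" if "j < dig k"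
    proof (cases "frozen j")
      case True
      then show ?thesis using assms by (simp add: main_def)
    next
      case False
      then obtain i where "j = dig i" by (rule dig_cases)
      then show ?thesis using that less_k by simp
    qed
    ultimately show "inf_act c r' !! j = r !! j"
      using k r'_snth[of j] by (cases "j < dig k"; cases "j = dig k") simp_all
  qed
  ultimately show ?thesis using that by blast
qed

lemma pos_bij: "bij_betw pos main UNIV"
proof -
  obtain r0 where r0: "r0 \<in> main" using main_nonempty by blast
  have "n \<in> pos ` main" for n
  proof (induction n rule: int_induct[where k = "pos r0"])
    case base
    then show ?case using r0 by blast
  next
    case (step1 n)
    then obtain r where r: "r \<in> main" "n = pos r" by blast
    obtain r' where r': "r' \<in> main" "inf_act c r' = r" using r(1) by (rule main_predecessor)
    then have "pos r' = n + 1" using pos_act_c[OF r'(1)] r by simp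
    then show ?case using r'(1) by force
  next
    case (step2 n)
    then obtain r where r: "r \<in> main" "n = pos r" by blast
    then have "pos (inf_act c r) = n - 1" by (simp add: pos_act_c)
    then show ?case using main_act_c_in_main[OF r(1)] by force
  qed
  then show ?thesis using pos_inj by (auto simp: bij_betw_def)
qed

text \<open>The constant in the definition of \<^term>\<open>pos\<close> is right: the residue class modulo
  \<^term>\<open>2 ^ Suc k\<close> of the coordinate determines the first \<^term>\<open>Suc k\<close> digits, and the class
  that belongs to the digits \<open>0...01\<close> is \<^term>\<open>A' \<gamma> k\<close>.\<close>

lemma pos_in_A'_iff:
  assumes \<gamma>: "\<And>i. \<gamma> (Suc i) = \<xi> !! dig i" and r: "r \<in> main"
  shows "pos r \<in> A' \<gamma> k \<longleftrightarrow> lead r = k"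
proof -
  let ?x = "bin (\<lambda>i. \<xi> !! dig i)" and ?b = "bin (\<lambda>i. r !! dig i)"
  let ?S = "\<Sum>i=1..k. 2 ^ i * of_bool (\<gamma> (i + 1)) :: int"
  have S: "?x (Suc k) = of_bool (\<xi> !! dig 0) + ?S"
    by (induction k) (simp_all add: bin_Suc \<gamma>)
  obtain M where M: "\<forall>k\<ge>M. r !! dig k = \<xi> !! dig k"
    using cls_dig_eq main_cls r by blast
  let ?N = "max M (Suc k)"
  have diff: "pos r - (2 ^ k - 1 - ?S) = (?b ?N - ?b (Suc k)) - (?x ?N - ?x (Suc k)) + (?b (Suc k) - 2 ^ k)"
    using pos_eq[of ?N r] M S by simp
  have "2 ^ Suc k dvd bin f ?N - bin f (Suc k)" for f
    using bin_cong_mod[of "Suc k" ?N f] by (simp add: cong_iff_dvd_diff del: power_Suc)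
  then have "2 ^ Suc k dvd (?b ?N - ?b (Suc k)) - (?x ?N - ?x (Suc k))"
    using dvd_diff by blast
  then have "2 ^ Suc k dvd pos r - (2 ^ k - 1 - ?S) \<longleftrightarrow> 2 ^ Suc k dvd ?b (Suc k) - 2 ^ k"
    unfolding diff by (rule dvd_add_right_iff)
  then have "pos r \<in> A' \<gamma> k \<longleftrightarrow> r !! dig k \<and> (\<forall>i<k. \<not> r !! dig i)"
    using bin_first_one_iff[of "\<lambda>i. r !! dig i" k] unfolding A'_iff cong_iff_dvd_diff by blast
  also have "\<dots> \<longleftrightarrow> lead r = k"
    using lead_digit[OF r] before_lead[OF r] by (metis dig_less_iff not_less_iff_gr_or_eq)
  finally show ?thesis .
qed


section \<open>Hanging the branches on the main line\<close>

text \<open>The decoration at a word \<^term>\<open>r\<close> of the main line, with its first 1 at the index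
  \<^term>\<open>dig k\<close>: a word \<^term>\<open>u\<close> of length \<^term>\<open>dsize k\<close> on the relevant side of the zero word ends in
  0, and its other letters replace the letters of \<^term>\<open>r\<close> before the first 1.\<close>

definition hang :: "bool stream \<Rightarrow> bool list \<Rightarrow> bool stream" where
  "hang r u = butlast u @- sdrop (dig (lead r)) r"

definition items :: "(bool stream \<times> bool list) set" where
  "items = {(r, u). r \<in> main \<and> u \<in> branch (dsize (lead r))}"

lemma branch_snoc:
  assumes "u \<in> branch (dsize k)"
  obtains x where "u = x @ [False]" "length x = dig k"
proof -
  have "length u = Suc (dig k)" using assms by (simp add: branch_def dsize_dig)
  then obtain x z where x: "u = x @ [z]" "length x = dig k" by (cases u rule: rev_cases) auto
  then have "\<not> z" using assms by (auto simp: branch_def dsize_dig)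
  then show ?thesis using x that by auto
qed

lemma main_sdrop:
  assumes "r \<in> main"
  shows "sdrop (dig (lead r)) r = True ## sdrop (dsize (lead r)) r"
  using arg_cong[OF main_split[OF assms], of "sdrop (dig (lead r))"] by (simp add: sdrop_shift)

lemma hang_snoc:
  assumes "r \<in> main"
  shows "hang r (x @ [z]) = x @- True ## sdrop (dsize (lead r)) r"
  using main_sdrop[OF assms] by (simp add: hang_def)

lemma hang_zeros:
  assumes "r \<in> main"
  shows "hang r (zeros (dsize (lead r))) = r"
  using hang_snoc[OF assms] main_split[OF assms] by (simp add: dsize_dig zeros_snoc)

lemma hang_snth:
  assumes "r \<in> main" "u \<in> branch (dsize (lead r))"
  shows "hang r u !! j = (if j < dig (lead r) then u ! j else r !! j)"
proof -
  obtain x where x: "u = x @ [False]" "length x = dig (lead r)"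
    using assms(2) by (rule branch_snoc)
  show ?thesis
    using x by (simp add: hang_def shift_snth sdrop_snth nth_append)
qed

lemma hang_in_cls:
  assumes "r \<in> main" "u \<in> branch (dsize (lead r))"
  shows "hang r u \<in> cls"
proof -
  have "cofinal (hang r u) r"
    unfolding cofinal_def using hang_snth[OF assms] by (intro exI[of _ "dig (lead r)"]) simp
  then show ?thesis using assms(1) main_cls cls_cofinal by blast
qed

text \<open>The last 1 of \<^term>\<open>u\<close> is a frozen letter, because an odd number of zeros follows it.\<close>

lemma branch_frozen_one:
  assumes u: "u \<in> branch (dsize k)" and i: "i < k" "u ! dig i"
  obtains j where "frozen j" "dig i < j" "j < dig k" "u ! j"
proof -
  have "u \<noteq> zeros (length u)"
    using i u by (auto simp: dsize_dig branch_def less_SucI)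
  then obtain p where p: "u = p @ True # zeros (trailing_zeros u)"
    by (rule last_one_cases)
  define t where "t = trailing_zeros u"
  have t: "odd t"
    using u \<open>u \<noteq> zeros (length u)\<close> by (auto simp: t_def branch_def)
  have p: "u = p @ True # zeros t" using p t_def by simp
  have "length p + t = dig k"
    using u arg_cong[OF p, of length] by (simp add: branch_def dsize_dig)
  then have "\<not> frozen (length p + t)" by simp
  have "length p < dig k"
    using odd_pos[OF t] \<open>length p + t = dig k\<close> by linarith
  have "frozen (length p)"
    using t \<open>\<not> frozen (length p + t)\<close> by (simp add: frozen_def)
  moreover have "dig i < length p"
  proof (rule ccontr)
    assume "\<not> dig i < length p"
    moreover have "dig i \<noteq> length p" using \<open>frozen (length p)\<close> not_frozen_dig by metis
    ultimately obtain q where q: "dig i = Suc (length p + q)"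
      by (metis less_imp_Suc_add linorder_neqE_nat)
    have "dig i < dig k" using i by simp
    then have "q < t" using q \<open>length p + t = dig k\<close> by simp
    then show False using i(2) p q by (simp add: nth_append)
  qed
  moreover have "u ! length p" by (simp add: p)
  ultimately show ?thesis using that \<open>length p < dig k\<close> by blast
qed

text \<open>A word in the class determines the place where it hangs: \<^term>\<open>lead r\<close> is the least
  \<^term>\<open>k\<close> such that the digit with number \<^term>\<open>k\<close> is 1 and all frozen letters after it are 0.\<close>

lemma hang_lead_le:
  assumes "r \<in> main" "u \<in> branch (dsize (lead r))" "r' \<in> main" "u' \<in> branch (dsize (lead r'))"
    and "hang r u = hang r' u'"
  shows "lead r' \<le> lead r"
proof (rule ccontr)
  assume "\<not> lead r' \<le> lead r"
  then have less: "lead r < lead r'" by simp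
  then have "dig (lead r) < dig (lead r')" by simp
  then have "u' ! dig (lead r)"
    using hang_snth[OF assms(1,2), of "dig (lead r)"] hang_snth[OF assms(3,4), of "dig (lead r)"]
      lead_digit[OF assms(1)] assms(5) by simp
  then obtain j where j: "frozen j" "dig (lead r) < j" "j < dig (lead r')" "u' ! j"
    using branch_frozen_one[OF assms(4) less] by blast
  then have "r !! j"
    using hang_snth[OF assms(1,2), of j] hang_snth[OF assms(3,4), of j] assms(5) by simp
  then show False using j(1) assms(1) by (simp add: main_def)
qed

lemma hang_inj: "inj_on (\<lambda>(r, u). hang r u) items"
proof (rule inj_onI, clarify)
  fix r u r' u'
  assume "(r, u) \<in> items" "(r', u') \<in> items" and eq: "hang r u = hang r' u'"
  then have r: "r \<in> main" "u \<in> branch (dsize (lead r))" and r': "r' \<in> main" "u' \<in> branch (dsize (lead r'))"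
    by (auto simp: items_def)
  have k: "lead r' = lead r"
    using hang_lead_le[OF r r' eq] hang_lead_le[OF r' r eq[symmetric]] by simp
  obtain x where x: "u = x @ [False]" "length x = dig (lead r)" using r(2) by (rule branch_snoc)
  obtain x' where x': "u' = x' @ [False]" "length x' = dig (lead r)"
    using r'(2) unfolding k by (rule branch_snoc)
  have streams: "x @- True ## sdrop (dsize (lead r)) r = x' @- True ## sdrop (dsize (lead r)) r'"
    using eq hang_snoc[OF r(1)] hang_snoc[OF r'(1)] x x' k by simp
  have "x = x'"
    using arg_cong[OF streams, of "stake (dig (lead r))"] x(2) x'(2) by (simp add: stake_shift)
  moreover have "sdrop (dsize (lead r)) r = sdrop (dsize (lead r)) r'"
    using arg_cong[OF streams, of "sdrop (dig (lead r))"] x(2) x'(2) by (simp add: sdrop_shift)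
  ultimately show "r = r' \<and> u = u'"
    using main_split[OF r(1)] main_split[OF r'(1)] x x' k by metis
qed

lemma hang_surj:
  assumes "v \<in> cls"
  obtains r u where "(r, u) \<in> items" "hang r u = v"
proof -
  define P where "P k \<longleftrightarrow> v !! dig k \<and> (\<forall>j\<ge>dsize k. frozen j \<longrightarrow> \<not> v !! j)" for k
  define k where "k = (LEAST k. P k)"
  have "\<exists>k. P k"
  proof -
    obtain N where N: "\<forall>j\<ge>N. frozen j \<longrightarrow> \<not> v !! j" using cls_frozen[OF assms] by blast
    obtain k where "k \<ge> N" "v !! dig k" using cls_digit_one[OF assms] by blast
    moreover have "dsize k \<ge> k" by (simp add: dsize_def)
    ultimately show ?thesis using N by (auto simp: P_def intro!: exI[of _ k])
  qed
  then have k: "P k" unfolding k_def by (rule LeastI_ex)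
  have least: "\<not> P i" if "i < k" for i using that not_less_Least unfolding k_def by blast
  define r where "r = zeros (dig k) @- True ## sdrop (dsize k) v"
  define u where "u = stake (dig k) v @ [False]"
  have v: "v = stake (dig k) v @- True ## sdrop (dsize k) v"
    using k id_stake_snth_sdrop[of v "dig k"] by (simp add: P_def dsize_dig)
  have r_snth: "r !! j = (if j < dig k then False else v !! j)" for j
    by (subst v) (simp add: r_def shift_snth)
  have "cofinal r v"
    unfolding cofinal_def using r_snth by (intro exI[of _ "dig k"]) simp
  moreover have "\<not> r !! j" if "frozen j" for j
  proof -
    have "j \<noteq> dig k" using that by auto
    then show ?thesis using that k r_snth by (auto simp: P_def dsize_dig)
  qed
  ultimately have r: "r \<in> main" using assms cls_cofinal by (auto simp: main_def)
  have lead: "lead r = k" using r_def by (rule lead_eq)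
  \<comment> \<open>otherwise the last 1 of \<^term>\<open>u\<close> is a digit, and this digit contradicts the minimality of
    \<^term>\<open>k\<close>\<close>
  have u: "u \<in> branch (dsize k)"
  proof (rule ccontr)
    assume not: "u \<notin> branch (dsize k)"
    have len: "length u = Suc (dig k)" by (simp add: u_def)
    then have nz: "u \<noteq> zeros (length u)" and ev: "even (trailing_zeros u)"
      using not by (auto simp: branch_def dsize_dig)
    define t where "t = trailing_zeros u"
    obtain p where p: "u = p @ True # zeros t" using nz unfolding t_def by (rule last_one_cases)
    have lp: "length p + t = dig k" using len p by simp
    have "t \<noteq> 0" unfolding t_def u_def by simp
    then have less: "length p < dig k" using lp by simp
    have "\<not> frozen (length p)"
      using ev lp not_frozen_dig[of k] unfolding t_def[symmetric]
      by (metis even_add frozen_def)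
    then obtain i where i: "length p = dig i" by (rule dig_cases)
    have u_v: "u ! j = v !! j" if "j < dig k" for j
      using that by (simp add: u_def nth_append)
    have "\<not> v !! j" if j: "frozen j" "j \<ge> dsize i" for j
    proof -
      have "j \<noteq> dig k" using j(1) by auto
      then consider "j < dig k" | "j \<ge> dsize k"
        by (fastforce simp: dsize_dig)
      then show ?thesis
      proof cases
        case 1
        obtain q where q: "j = Suc (length p + q)"
          using j(2) i by (metis dsize_dig Suc_le_lessD less_imp_Suc_add)
        then have "\<not> u ! j" using p 1 lp by (simp add: nth_append)
        then show ?thesis using u_v 1 by simp
      next
        case 2
        then show ?thesis using k j(1) by (simp add: P_def)
      qed
    qed
    moreover have "v !! dig i"
      using u_v[OF less] p i by (metis nth_append_length)
    ultimately have "P i" by (simp add: P_def)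
    then show False using least[of i] less i by simp
  qed
  have "sdrop (dsize k) r = sdrop (dsize k) v"
    by (simp add: r_def sdrop_shift dsize_dig)
  then have "hang r u = v"
    using v hang_snoc[OF r, of "stake (dig k) v" False] unfolding u_def lead by argo
  then show ?thesis using that r u lead by (auto simp: items_def)
qed

lemma hang_bij: "bij_betw (\<lambda>(r, u). hang r u) items cls"
  unfolding bij_betw_def
proof
  show "(\<lambda>(r, u). hang r u) ` items = cls"
  proof
    show "(\<lambda>(r, u). hang r u) ` items \<subseteq> cls"
      using hang_in_cls by (auto simp: items_def)
    show "cls \<subseteq> (\<lambda>(r, u). hang r u) ` items"
    proof
      fix v assume "v \<in> cls"
      then obtain r u where "(r, u) \<in> items" "hang r u = v" by (rule hang_surj)
      then show "v \<in> (\<lambda>(r, u). hang r u) ` items" by force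
    qed
  qed
qed (rule hang_inj)

lemma gen_at_dsize: "gen_at s (dsize k) = Gen_a \<longleftrightarrow> s = c"
  using gen_at_c[of "dsize k"] gen_at_Gen_b_other[of s "dsize k"] by (cases "gen_at s (dsize k)") auto

text \<open>Apart from the edges of the main line, the generators act on \<^term>\<open>hang r u\<close> as they act on
  \<^term>\<open>u\<close>: a carry out of \<^term>\<open>butlast u\<close> meets the next letter as \<^term>\<open>Gen_a\<close>, so it
  changes neither the 1 that follows it in the stream nor the 0 that follows it in \<^term>\<open>u\<close>.\<close>

lemma hang_act:
  assumes r: "r \<in> main" and u: "u \<in> branch (dsize (lead r))"
    and edge: "\<not> (u = zeros (dsize (lead r)) \<and> s = c)"
  shows "inf_act s (hang r u) = hang r (fin_act s u)"
proof -
  let ?k = "lead r"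
  obtain x where x: "u = x @ [False]" "length x = dig ?k" using u by (rule branch_snoc)
  show ?thesis
  proof (cases "x = zeros (dig ?k)")
    case False
    then show ?thesis
      using x by (simp add: hang_snoc[OF r] inf_act_shift_no_carry fin_act_append_no_carry)
  next
    case True
    then have "s \<noteq> c" using edge x by (simp add: dsize_dig zeros_snoc)
    then have s: "gen_at s (dig ?k) = Gen_a"
      using gen_at_Gen_b_other[of s "dig ?k"] by auto
    show ?thesis
      using x True s
      by (simp add: hang_snoc[OF r] inf_act_shift_carry fin_act_append_carry fin_act_0 inf_act_1
          del: fin_act.simps)
  qed
qed

end


section \<open>The isomorphism\<close>

text \<open>Two graphs are isomorphic if their vertices and edges are enumerated by the same sets such that
  the enumerations have the same endpoints.\<close>

lemma mgraph_iso_common: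
  assumes GV: "bij_betw gv X (verts G)" and HV: "bij_betw hv X (verts H)"
    and GE: "bij_betw ge Y (edges G)" and HE: "bij_betw he Y (edges H)"
    and ends: "\<And>y. y \<in> Y \<Longrightarrow> \<exists>x1\<in>X. \<exists>x2\<in>X.
      ends G (ge y) = Upair (gv x1) (gv x2) \<and> ends H (he y) = Upair (hv x1) (hv x2)"
  shows "mgraph_iso G H"
proof -
  let ?f = "hv \<circ> inv_into X gv" and ?\<phi> = "he \<circ> inv_into Y ge"
  have f: "?f (gv x) = hv x" if "x \<in> X" for x
    using that GV by (simp add: bij_betw_def)
  have "ends H (?\<phi> e) = map_uprod ?f (ends G e)" if "e \<in> edges G" for e
  proof -
    have "e \<in> ge ` Y" using that GE by (simp add: bij_betw_def)
    then obtain y where y: "y \<in> Y" "e = ge y" by blast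
    then obtain x1 x2 where "x1 \<in> X" "x2 \<in> X"
      "ends G e = Upair (gv x1) (gv x2)" "ends H (he y) = Upair (hv x1) (hv x2)"
      using ends by blast
    moreover have "?\<phi> e = he y"
      using y GE by (simp add: bij_betw_def)
    ultimately show ?thesis using f by simp
  qed
  moreover have "bij_betw ?f (verts G) (verts H)" "bij_betw ?\<phi> (edges G) (edges H)"
    using bij_betw_trans[OF bij_betw_inv_into[OF GV] HV]
      bij_betw_trans[OF bij_betw_inv_into[OF GE] HE] .
  ultimately show ?thesis unfolding mgraph_iso_def by blast
qed

context two_ended
begin

definition vert_map :: "bool stream \<times> bool list \<Rightarrow> int + int \<times> nat \<times> bool list" where
  "vert_map = (\<lambda>(r, u). glue dsize (pos r) (lead r) u)"

text \<open>An edge of the path is named after its lower end, and \<^term>\<open>c\<close> leads downwards from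
  \<^term>\<open>pos r\<close>.\<close>

definition edge_map ::
  "(bool stream \<times> bool list) \<times> gen \<Rightarrow> int + int \<times> nat \<times> bool list \<times> gen" where
  "edge_map = (\<lambda>((r, u), s).
    if u = zeros (dsize (lead r)) \<and> s = c then Inl (pos r - 1) else Inr (pos r, lead r, u, s))"

lemma dsize_ge_1: "dsize k \<ge> 1"
  by (simp add: dsize_dig)

lemma main_at:
  obtains r where "r \<in> main" "pos r = n"
  using pos_bij by (metis (no_types) UNIV_I bij_betw_iff_bijections)

lemma pos_eqD: "r \<in> main \<Longrightarrow> r' \<in> main \<Longrightarrow> pos r = pos r' \<Longrightarrow> r = r'"
  using pos_inj by (auto dest: inj_onD)

context
  fixes \<gamma> :: "nat \<Rightarrow> bool"
  assumes \<gamma>: "\<And>i. \<gamma> (Suc i) = \<xi> !! dig i"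
begin

lemma vert_map_bij: "bij_betw vert_map items (verts (decorated_path (A' \<gamma>) dsize))"
proof -
  have verts: "verts (decorated_path (A' \<gamma>) dsize) =
      range Inl \<union> {glue dsize n k w | n k w. n \<in> A' \<gamma> k \<and> w \<in> branch (dsize k)}"
    by (simp add: decorated_path_def verts_decoration[OF dsize_ge_1])
  show ?thesis
    unfolding bij_betw_def
  proof
    show "inj_on vert_map items"
      by (rule inj_onI)
        (auto simp: vert_map_def items_def glue_def split: if_splits dest: pos_eqD)
    show "vert_map ` items = verts (decorated_path (A' \<gamma>) dsize)"
    proof
      show "vert_map ` items \<subseteq> verts (decorated_path (A' \<gamma>) dsize)"
      proof clarify
        fix r u assume "(r, u) \<in> items"
        then have "pos r \<in> A' \<gamma> (lead r)" "u \<in> branch (dsize (lead r))"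
          using pos_in_A'_iff[OF \<gamma>] by (auto simp: items_def)
        then show "vert_map (r, u) \<in> verts (decorated_path (A' \<gamma>) dsize)"
          unfolding verts vert_map_def prod.case by blast
      qed
      show "verts (decorated_path (A' \<gamma>) dsize) \<subseteq> vert_map ` items"
      proof
        fix x assume "x \<in> verts (decorated_path (A' \<gamma>) dsize)"
        then consider n where "x = Inl n"
          | n k w where "x = glue dsize n k w" "n \<in> A' \<gamma> k" "w \<in> branch (dsize k)"
          unfolding verts by blast
        then show "x \<in> vert_map ` items"
        proof cases
          case 1
          obtain r where "r \<in> main" "pos r = n" by (rule main_at)
          then show ?thesis using 1
            by (intro image_eqI[of _ _ "(r, zeros (dsize (lead r)))"])
              (auto simp: vert_map_def items_def glue_def)
        next
          case 2
          obtain r where r: "r \<in> main" "pos r = n" by (rule main_at)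
          then have "lead r = k" using pos_in_A'_iff[OF \<gamma>] 2 by blast
          then show ?thesis using 2 r
            by (intro image_eqI[of _ _ "(r, w)"]) (auto simp: vert_map_def items_def)
        qed
      qed
    qed
  qed
qed

lemma edges_decorated_path:
  "edges (decorated_path (A' \<gamma>) dsize) = range Inl \<union>
    {Inr (n, k, w, s) | n k w s.
      n \<in> A' \<gamma> k \<and> w \<in> branch (dsize k) \<and> \<not> (w = zeros (dsize k) \<and> s = c)}"
  by (auto simp: decorated_path_def edges_decoration[OF dsize_ge_1] gen_at_dsize)

lemma edge_map_bij:
  "bij_betw edge_map (items \<times> UNIV) (edges (decorated_path (A' \<gamma>) dsize))"
  unfolding bij_betw_def
proof
  show "inj_on edge_map (items \<times> UNIV)"
    by (rule inj_onI) (auto simp: edge_map_def items_def split: if_splits dest: pos_eqD)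
  show "edge_map ` (items \<times> UNIV) = edges (decorated_path (A' \<gamma>) dsize)"
  proof
    show "edge_map ` (items \<times> UNIV) \<subseteq> edges (decorated_path (A' \<gamma>) dsize)"
      unfolding edges_decorated_path using pos_in_A'_iff[OF \<gamma>]
      by (auto simp: edge_map_def items_def)
    show "edges (decorated_path (A' \<gamma>) dsize) \<subseteq> edge_map ` (items \<times> UNIV)"
    proof
      fix x assume "x \<in> edges (decorated_path (A' \<gamma>) dsize)"
      then consider n where "x = Inl n"
        | n k w s where "x = Inr (n, k, w, s)" "n \<in> A' \<gamma> k" "w \<in> branch (dsize k)"
          "\<not> (w = zeros (dsize k) \<and> s = c)"
        unfolding edges_decorated_path by blast
      then show "x \<in> edge_map ` (items \<times> UNIV)"
      proof cases
        case 1
        obtain r where "r \<in> main" "pos r = n + 1" by (rule main_at)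
        then show ?thesis using 1
          by (intro image_eqI[of _ _ "((r, zeros (dsize (lead r))), c)"])
            (auto simp: edge_map_def items_def)
      next
        case 2
        obtain r where r: "r \<in> main" "pos r = n" by (rule main_at)
        then have "lead r = k" using pos_in_A'_iff[OF \<gamma>] 2 by blast
        then show ?thesis using 2 r
          by (intro image_eqI[of _ _ "((r, w), s)"]) (auto simp: edge_map_def items_def)
      qed
    qed
  qed
qed

lemma ends_edge_map:
  assumes "(r, u) \<in> items"
  shows "\<exists>x1\<in>items. \<exists>x2\<in>items.
    Upair (hang r u) (inf_act s (hang r u)) =
      Upair ((\<lambda>(r, u). hang r u) x1) ((\<lambda>(r, u). hang r u) x2) \<and>
    ends (decorated_path (A' \<gamma>) dsize) (edge_map ((r, u), s)) = Upair (vert_map x1) (vert_map x2)"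
proof -
  have r: "r \<in> main" and u: "u \<in> branch (dsize (lead r))"
    using assms by (auto simp: items_def)
  show ?thesis
  proof (cases "u = zeros (dsize (lead r)) \<and> s = c")
    case True
    let ?r' = "inf_act c r"
    have r': "?r' \<in> main" using r by (rule main_act_c_in_main)
    then have "(?r', zeros (dsize (lead ?r'))) \<in> items" by (simp add: items_def)
    moreover have "ends (decorated_path (A' \<gamma>) dsize) (edge_map ((r, u), s)) =
        Upair (vert_map (r, u)) (vert_map (?r', zeros (dsize (lead ?r'))))"
      using True pos_act_c[OF r]
      by (simp add: edge_map_def decorated_path_def vert_map_def glue_def Upair_inject)
    ultimately show ?thesis
      using True assms hang_zeros[OF r] hang_zeros[OF r']
      by (intro bexI[of _ "(r, u)"] bexI[of _ "(?r', zeros (dsize (lead ?r')))"]) auto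
  next
    case False
    let ?k = "lead r"
    have edge: "(u, s) \<in> edges (decoration (dsize ?k))"
      using u False by (simp add: edges_decoration[OF dsize_ge_1] gen_at_dsize)
    have "fin_act s u \<in> branch (dsize ?k)"
      using u False fin_act_branch[of u "dsize ?k" s] fin_act_zeros_branch[OF dsize_ge_1, of s ?k]
        gen_at_dsize[of s ?k] by (cases "u = zeros (dsize ?k)") (auto simp: gen_not_a[symmetric] simp del: gen_not_a)
    then have "(r, fin_act s u) \<in> items" using r by (simp add: items_def)
    moreover have "edge_map ((r, u), s) = Inr (pos r, ?k, u, s)"
      using False by (auto simp: edge_map_def)
    then have "ends (decorated_path (A' \<gamma>) dsize) (edge_map ((r, u), s)) =
        Upair (vert_map (r, u)) (vert_map (r, fin_act s u))"
      using ends_decoration[OF dsize_ge_1 edge]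
      by (simp add: decorated_path_def vert_map_def)
    ultimately show ?thesis
      using assms hang_act[OF r u False]
      by (intro bexI[of _ "(r, u)"] bexI[of _ "(r, fin_act s u)"]) auto
  qed
qed

lemma schreier_iso_decorated_path: "mgraph_iso (Gamma_inf \<xi>) (decorated_path (A' \<gamma>) dsize)"
proof (rule mgraph_iso_common)
  show "bij_betw (\<lambda>(r, u). hang r u) items (verts (Gamma_inf \<xi>))"
    using hang_bij by (simp add: Gamma_inf_def schreier_def basilica_orbit_eq)
  show "bij_betw vert_map items (verts (decorated_path (A' \<gamma>) dsize))"
    by (rule vert_map_bij)
  show "bij_betw (map_prod (\<lambda>(r, u). hang r u) id) (items \<times> UNIV) (edges (Gamma_inf \<xi>))"
    using hang_bij
    by (simp add: Gamma_inf_def schreier_def basilica_orbit_eq bij_betw_def map_prod_inj_on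
        map_prod_surj_on)
  show "bij_betw edge_map (items \<times> UNIV) (edges (decorated_path (A' \<gamma>) dsize))"
    by (rule edge_map_bij)
next
  fix y assume "y \<in> items \<times> (UNIV :: gen set)"
  then obtain r u s where y: "y = ((r, u), s)" "(r, u) \<in> items" by auto
  then show "\<exists>x1\<in>items. \<exists>x2\<in>items.
      ends (Gamma_inf \<xi>) (map_prod (\<lambda>(r, u). hang r u) id y) =
        Upair ((\<lambda>(r, u). hang r u) x1) ((\<lambda>(r, u). hang r u) x2) \<and>
      ends (decorated_path (A' \<gamma>) dsize) (edge_map y) = Upair (vert_map x1) (vert_map x2)"
    using ends_edge_map[OF y(2), of s] by (simp add: Gamma_inf_def schreier_def)
qed

end

end


section \<open>The words with two-ended Schreier graphs\<close>

lemma finitely_many_ones_iff: "finitely_many_ones \<gamma> \<longleftrightarrow> (\<exists>N. \<forall>i\<ge>N. \<not> \<gamma> (Suc i))"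
proof
  assume "finitely_many_ones \<gamma>"
  then obtain N where "\<forall>i\<in>{i. i \<ge> 1 \<and> \<gamma> i}. i \<le> N"
    unfolding finitely_many_ones_def using finite_nat_set_iff_bounded_le by blast
  then show "\<exists>N. \<forall>i\<ge>N. \<not> \<gamma> (Suc i)" by (intro exI[of _ N]) auto
next
  assume "\<exists>N. \<forall>i\<ge>N. \<not> \<gamma> (Suc i)"
  then obtain N where N: "\<forall>i\<ge>N. \<not> \<gamma> (Suc i)" by blast
  have "{i. i \<ge> 1 \<and> \<gamma> i} \<subseteq> {..N}"
  proof
    fix i assume "i \<in> {i. i \<ge> 1 \<and> \<gamma> i}"
    then obtain n where n: "i = Suc n" "\<gamma> (Suc n)" by (cases i) auto
    then have "n < N" using N not_le by blast
    then show "i \<in> {..N}" using n by simp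
  qed
  then show "finitely_many_ones \<gamma>"
    unfolding finitely_many_ones_def using finite_subset finite_atMost by blast
qed

lemma alternating_snth: "cycle [False, True] !! j \<longleftrightarrow> odd j"
proof -
  have period: "cycle [False, True] = False ## True ## cycle [False, True]"
    using cycle_decomp[of "[False, True]"] by simp
  have "(cycle [False, True] !! j \<longleftrightarrow> odd j) \<and> (cycle [False, True] !! Suc j \<longleftrightarrow> even j)"
  proof (induction j)
    case 0
    show ?case by (subst (1 2) period) simp
  next
    case (Suc j)
    have "cycle [False, True] !! Suc (Suc j) = cycle [False, True] !! j"
      by (subst period) simp
    then show ?case using Suc by auto
  qed
  then show ?thesis by blast
qed

text \<open>A word in \<^term>\<open>E2\<close> ends neither in only zeros nor in alternating letters. Its first part is cut
  off at an even index, so that the alternating words start with 0.\<close>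

lemma E2_not_constant:
  assumes "\<xi> \<in> E2"
  shows "\<exists>j\<ge>N. \<xi> !! j" and "\<exists>j\<ge>N. \<xi> !! j \<noteq> odd j"
proof -
  have split: "\<xi> = stake (2 * N) \<xi> @- sdrop (2 * N) \<xi>"
    by (simp add: stake_sdrop)
  show "\<exists>j\<ge>N. \<xi> !! j"
  proof (rule ccontr)
    assume "\<nexists>j. j \<ge> N \<and> \<xi> !! j"
    then have "sdrop (2 * N) \<xi> = sconst False"
      by (intro stream_eqI) (simp add: sdrop_snth)
    then show False using assms split unfolding E2_def by auto
  qed
  show "\<exists>j\<ge>N. \<xi> !! j \<noteq> odd j"
  proof (rule ccontr)
    assume "\<not> (\<exists>j\<ge>N. \<xi> !! j \<noteq> odd j)"
    then have "sdrop (2 * N) \<xi> = cycle [False, True]"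
      by (intro stream_eqI) (simp add: sdrop_snth alternating_snth)
    then show False using assms split unfolding E2_def by auto
  qed
qed

text \<open>If the letters at the frozen indices are eventually 0, then constant digits would make the word
  end in only zeros or in alternating letters.\<close>

lemma two_ended_E2:
  assumes \<xi>: "\<xi> \<in> E2" and c_e: "c = Gen_a \<and> e = 2 \<or> c = Gen_b \<and> e = 1"
    and frozen: "\<exists>N. \<forall>j\<ge>N. even (j + e) \<longrightarrow> \<not> \<xi> !! j"
  shows "two_ended \<xi> c e"
proof
  show "c = Gen_a \<and> e = 2 \<or> c = Gen_b \<and> e = 1" by (rule c_e)
  show "\<exists>N. \<forall>j\<ge>N. even (j + e) \<longrightarrow> \<not> \<xi> !! j" by (rule frozen)
  have digit: "\<exists>k. j = 2 * k + e - 1" if "odd (j + e)" for j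
    using that c_e by (intro exI[of _ "j div 2"]) (elim disjE conjE; hypsubst; presburger)
  have le: "e \<ge> 1" "e \<le> 2" using c_e by auto
  obtain M where M: "\<forall>j\<ge>M. even (j + e) \<longrightarrow> \<not> \<xi> !! j" using frozen by blast
  fix N
  let ?L = "max M (2 * N + 2)"
  show "\<exists>k\<ge>N. \<xi> !! (2 * k + e - 1)"
  proof -
    obtain j where j: "j \<ge> ?L" "\<xi> !! j" using E2_not_constant(1)[OF \<xi>] by blast
    then obtain k where k: "j = 2 * k + e - 1" using M digit by (meson max.boundedE)
    have "2 * N + 2 \<le> j" using j(1) by simp
    then have "k \<ge> N" using k le by linarith
    then show ?thesis using j k by blast
  qed
  show "\<exists>k\<ge>N. \<not> \<xi> !! (2 * k + e - 1)"
  proof (rule ccontr)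
    assume *: "\<not> (\<exists>k\<ge>N. \<not> \<xi> !! (2 * k + e - 1))"
    have tail: "\<xi> !! j \<longleftrightarrow> odd (j + e)" if "j \<ge> ?L" for j
    proof (cases "even (j + e)")
      case False
      then obtain k where k: "j = 2 * k + e - 1" using digit by blast
      have "2 * N + 2 \<le> j" using that by simp
      then have "k \<ge> N" using k le by linarith
      then show ?thesis using * k False by blast
    qed (use M that in auto)
    show False
    proof (cases "even e")
      case True
      then show False using tail E2_not_constant(2)[OF \<xi>, of ?L] by auto
    next
      case False
      \<comment> \<open>now the ones are at the even indices, so a tail that starts with 0 begins at an odd index\<close>
      have far: "n \<le> Suc (2 * n) + j" for n j :: nat
        by simp
      have "\<xi> !! (Suc (2 * ?L) + j) \<longleftrightarrow> odd j" for j
        using tail[OF far] False by simp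
      then have "sdrop (Suc (2 * ?L)) \<xi> = cycle [False, True]"
        by (intro stream_eqI)
          (simp only: sdrop_snth alternating_snth add.commute[of _ "Suc (2 * ?L)"])
      then have "\<xi> = stake (Suc (2 * ?L)) \<xi> @- cycle [False, True]"
        by (metis stake_sdrop)
      then show False using \<xi> unfolding E2_def by blast
    qed
  qed
qed

theorem theorem4p11:
  fixes \<xi> :: "bool stream"
  assumes "\<xi> \<in> E2"
  shows "mgraph_iso (Gamma_inf \<xi>) (model_graph \<xi>)"
proof (cases "\<xi> \<in> E2_even")
  case True
  then obtain N where N: "\<forall>i\<ge>N. \<not> alpha \<xi> (Suc i)"
    by (auto simp: E2_even_def finitely_many_ones_iff)
  have "\<forall>j\<ge>2 * N. even (j + 2) \<longrightarrow> \<not> \<xi> !! j"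
    using N by (auto simp: alpha_def elim!: evenE)
  then interpret two_ended \<xi> Gen_a 2
    using assms by (intro two_ended_E2) auto
  have "dsize = (\<lambda>k. 2 * k + 2)" unfolding dsize_def by simp
  moreover have "beta \<xi> (Suc i) = \<xi> !! dig i" for i
    unfolding beta_def dig_def by simp
  ultimately show ?thesis
    using schreier_iso_decorated_path[of "beta \<xi>"] True
    by (simp add: model_graph_def)
next
  case False
  then have "finitely_many_ones (beta \<xi>)"
    using assms by (auto simp: E2_even_def E2_def)
  then obtain N where N: "\<forall>i\<ge>N. \<not> beta \<xi> (Suc i)"
    by (auto simp: finitely_many_ones_iff)
  have "\<forall>j\<ge>2 * N + 1. even (j + 1) \<longrightarrow> \<not> \<xi> !! j"
    using N by (auto simp: beta_def elim!: oddE)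
  then interpret two_ended \<xi> Gen_b 1
    using assms by (intro two_ended_E2) auto
  have "dsize = (\<lambda>k. 2 * k + 1)" unfolding dsize_def by simp
  moreover have "alpha \<xi> (Suc i) = \<xi> !! dig i" for i
    unfolding alpha_def dig_def by simp
  ultimately show ?thesis
    using schreier_iso_decorated_path[of "alpha \<xi>"] False
    by (simp add: model_graph_def)
qed

end
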